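(* Let $\mathbb{C}$ be a regular unital category with binary coproducts, comonadic covers $(P,\delta,\varepsilon)$ and a natural imaginary splitting $t$. Suppose that the natural addition $(\mu^X\colon X\times X\dashrightarrow X)_{X\in\mathbb{C}}$ is associative. Then the class of intrinsic Schreier split extensions (i.e. of intrinsic Schreier split epimorphisms) is equi-consistent.
   Context: Setting. A pointed finitely complete category is unital when for all objects $A,B$ the pair $\langle 1_A,0\rangle\colon A\to A\times B$, $\langle 0,1_B\rangle\colon B\to A\times B$ is jointly extremal-epimorphic. "Comonadic covers" means a comonad $(P,\delta,\varepsilon)$ on $\mathbb{C}$ such that every $\varepsilon_X\colon P(X)\to X$ is a regular epimorphism. A natural imaginary splitting is a natural transformation with components $t_{A,B}\colon P(A\times B)\to A+B$ such that $r_{A,B}t_{A,B}=\varepsilon_{A\times B}$, where $r_{A,B}\colon A+B\to A\times B$ is the canonical comparison morphism (with $\pi_A r_{A,B}=(1_A\;0)$ and $\pi_B r_{A,B}=(0\;1_B)$). Imaginary morphisms. An imaginary morphism $a\colon X\dashrightarrow Y$ is a morphism $a\colon P(X)\to Y$ in $\mathbb{C}$, i.e. a morphism of the Kleisli category of $P$; composition of $a\colon A\dashrightarrow B$ and $b\colon B\dashrightarrow C$ is $b\circ a=b\,P(a)\,\delta_A$. A real morphism $f\colon X\to Y$ of $\mathbb{C}$ is viewed as $\overline{f}=f\varepsilon_X\colon X\dashrightarrow Y$; for real $v$, $u$ one writes $v\circ a=va\;(=\overline{v}\circ a)$ and $a\circ u=aP(u)\;(=a\circ\overline{u})$. Finite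 products of $\mathbb{C}$ are also products for imaginary morphisms: $\langle a,b\rangle$ is the usual pairing in $\mathbb{C}$, and $a\times b=\langle a\circ\pi_1,b\circ\pi_2\rangle$. Imaginary addition: $\mu^X\colon X\times X\dashrightarrow X$ is $\mu^X=(1_X\;1_X)\,t_{X,X}\colon P(X\times X)\to X+X\to X$. The natural addition is associative when $\mu^X\circ(\mu^X\times\overline{1_X})=\mu^X\circ(\overline{1_X}\times\mu^X)$ as imaginary morphisms $X\times X\times X\dashrightarrow X$ for every object $X$. Intrinsic Schreier split epimorphism: a split epimorphism $f\colon X\to Y$ with chosen section $s$ and kernel $k\colon K\to X$ for which there is an imaginary morphism $q\colon X\dashrightarrow K$ with $\mu^X\circ\langle k\circ q,\overline{sf}\rangle=\overline{1_X}$ and $q\circ\mu^X\circ(k\times s)=\overline{\pi_K}$, where $\pi_K\colon K\times Y\to K$ is the projection. This class is stable under pullback. Equi-consistency. A point is a split epimorphism with a fixed section. A pullback-stable class $\mathcal{S}$ of points is equi-consistent if the following holds for all data as described. Let $(f\colon X\to Y,\ s\colon Y\to X)$ be a split epimorphism with section; let $\langle r_1,r_2\rangle\colon R\rightarrowtail X\times X$ and $\langle s_1,s_2\rangle\colon S\rightarrowtail Y\times Y$ be equivalence relations, with reflexivity morphisms $e_R\colon X\to R$ and $e_S\colon Y\to S$ (so $r_ie_R=1_X$, $s_ie_S=1_Y$); let $(f'\colon R\to S,\ s'\colon S\to R)$ be a split epimorphism with section such that $s_if'=fr_i$, $r_is'=ss_i$ ($i=1,2$), $f'e_R=e_Sf$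 and $s'e_S=e_Rs$; let $u\colon X''\to R$ be the kernel of $r_1$ and $v\colon Y''\to S$ the kernel of $s_1$, and let $(f''\colon X''\to Y'',\ s''\colon Y''\to X'')$ be the induced split epimorphism with section ($vf''=f'u$, $us''=s'v$). Then whenever $(f,s)$, $(r_1,e_R)$ and $(f'',s'')$ belong to $\mathcal{S}$, also $(f',s')$ belongs to $\mathcal{S}$. *)

theory Defs
  imports Main
begin

section \<open>Categories\<close>

record ('o, 'm) cat =
  Obj :: "'o set"
  Arr :: "'m set"
  Dom :: "'m \<Rightarrow> 'o"
  Cod :: "'m \<Rightarrow> 'o"
  Ide :: "'o \<Rightarrow> 'm" ("\<one>\<index>")
  Comp :: "'m \<Rightarrow> 'm \<Rightarrow> 'm" (infixl "\<cdot>\<index>" 70)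

definition hom :: "('o, 'm, 'x) cat_scheme \<Rightarrow> 'o \<Rightarrow> 'o \<Rightarrow> 'm set" where
  "hom C A B = {f \<in> Arr C. Dom C f = A \<and> Cod C f = B}"

text \<open>\<open>g \<cdot> f\<close> is ``\<open>g\<close> after \<open>f\<close>'' and is only meaningful for composable arrows.\<close>

locale category =
  fixes C :: "('o, 'm, 'x) cat_scheme" (structure)
  assumes Dom_Obj: "f \<in> Arr C \<Longrightarrow> Dom C f \<in> Obj C"
    and Cod_Obj: "f \<in> Arr C \<Longrightarrow> Cod C f \<in> Obj C"
    and Ide_hom: "A \<in> Obj C \<Longrightarrow> \<one> A \<in> hom C A A"
    and Comp_hom: "f \<in> hom C A B \<Longrightarrow> g \<in> hom C B D \<Longrightarrow> g \<cdot> f \<in> hom C A D"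
    and Comp_Ide: "f \<in> hom C A B \<Longrightarrow> f \<cdot> \<one> A = f"
    and Ide_Comp: "f \<in> hom C A B \<Longrightarrow> \<one> B \<cdot> f = f"
    and Comp_assoc:
      "f \<in> hom C A B \<Longrightarrow> g \<in> hom C B D \<Longrightarrow> h \<in> hom C D E \<Longrightarrow> (h \<cdot> g) \<cdot> f = h \<cdot> (g \<cdot> f)"

definition isomorphism :: "('o, 'm, 'x) cat_scheme \<Rightarrow> 'm \<Rightarrow> bool" where
  "isomorphism C f \<longleftrightarrow> f \<in> Arr C \<and>
    (\<exists>g \<in> hom C (Cod C f) (Dom C f).
      g \<cdot>\<^bsub>C\<^esub> f = \<one>\<^bsub>C\<^esub> (Dom C f) \<and> f \<cdot>\<^bsub>C\<^esub> g = \<one>\<^bsub>C\<^esub> (Cod C f))"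

definition monic :: "('o, 'm, 'x) cat_scheme \<Rightarrow> 'm \<Rightarrow> bool" where
  "monic C m \<longleftrightarrow> m \<in> Arr C \<and>
    (\<forall>W. \<forall>a \<in> hom C W (Dom C m). \<forall>b \<in> hom C W (Dom C m).
      m \<cdot>\<^bsub>C\<^esub> a = m \<cdot>\<^bsub>C\<^esub> b \<longrightarrow> a = b)"

section \<open>Limits and colimits\<close>

definition is_terminal :: "('o, 'm, 'x) cat_scheme \<Rightarrow> 'o \<Rightarrow> bool" where
  "is_terminal C T \<longleftrightarrow> T \<in> Obj C \<and> (\<forall>A \<in> Obj C. \<exists>!f. f \<in> hom C A T)"

definition is_initial :: "('o, 'm, 'x) cat_scheme \<Rightarrow> 'o \<Rightarrow> bool" where
  "is_initial C I \<longleftrightarrow> I \<in> Obj C \<and> (\<forall>A \<in> Obj C. \<exists>!f. f \<in> hom C I A)"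

definition is_zero_object :: "('o, 'm, 'x) cat_scheme \<Rightarrow> 'o \<Rightarrow> bool" where
  "is_zero_object C Z \<longleftrightarrow> is_initial C Z \<and> is_terminal C Z"

definition pointed :: "('o, 'm, 'x) cat_scheme \<Rightarrow> bool" where
  "pointed C \<longleftrightarrow> (\<exists>Z. is_zero_object C Z)"

text \<open>In a pointed category the composite \<open>A \<rightarrow> Z \<rightarrow> B\<close> does not depend on the zero
  object \<open>Z\<close>, so the description below is well defined.\<close>

definition zero_arr :: "('o, 'm, 'x) cat_scheme \<Rightarrow> 'o \<Rightarrow> 'o \<Rightarrow> 'm" ("\<zero>\<index>") where
  "\<zero>\<^bsub>C\<^esub> A B =
    (THE z. \<exists>Z. is_zero_object C Z \<and> (\<exists>u \<in> hom C A Z. \<exists>v \<in> hom C Z B. z = v \<cdot>\<^bsub>C\<^esub> u))"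

definition is_product ::
  "('o, 'm, 'x) cat_scheme \<Rightarrow> 'o \<Rightarrow> 'o \<Rightarrow> 'o \<Rightarrow> 'm \<Rightarrow> 'm \<Rightarrow> bool" where
  "is_product C A B Q p1 p2 \<longleftrightarrow> p1 \<in> hom C Q A \<and> p2 \<in> hom C Q B \<and>
    (\<forall>W. \<forall>f \<in> hom C W A. \<forall>g \<in> hom C W B.
      \<exists>!h. h \<in> hom C W Q \<and> p1 \<cdot>\<^bsub>C\<^esub> h = f \<and> p2 \<cdot>\<^bsub>C\<^esub> h = g)"

definition is_coproduct ::
  "('o, 'm, 'x) cat_scheme \<Rightarrow> 'o \<Rightarrow> 'o \<Rightarrow> 'o \<Rightarrow> 'm \<Rightarrow> 'm \<Rightarrow> bool" where
  "is_coproduct C A B Q i1 i2 \<longleftrightarrow> i1 \<in> hom C A Q \<and> i2 \<in> hom C B Q \<and>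
    (\<forall>W. \<forall>f \<in> hom C A W. \<forall>g \<in> hom C B W.
      \<exists>!h. h \<in> hom C Q W \<and> h \<cdot>\<^bsub>C\<^esub> i1 = f \<and> h \<cdot>\<^bsub>C\<^esub> i2 = g)"

definition is_equalizer :: "('o, 'm, 'x) cat_scheme \<Rightarrow> 'm \<Rightarrow> 'm \<Rightarrow> 'm \<Rightarrow> bool" where
  "is_equalizer C f g e \<longleftrightarrow> e \<in> Arr C \<and> Cod C e = Dom C f \<and> f \<cdot>\<^bsub>C\<^esub> e = g \<cdot>\<^bsub>C\<^esub> e \<and>
    (\<forall>W. \<forall>h \<in> hom C W (Dom C f). f \<cdot>\<^bsub>C\<^esub> h = g \<cdot>\<^bsub>C\<^esub> h \<longrightarrow>
      (\<exists>!h'. h' \<in> hom C W (Dom C e) \<and> e \<cdot>\<^bsub>C\<^esub> h' = h))"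

definition is_coequalizer :: "('o, 'm, 'x) cat_scheme \<Rightarrow> 'm \<Rightarrow> 'm \<Rightarrow> 'm \<Rightarrow> bool" where
  "is_coequalizer C f g c \<longleftrightarrow> c \<in> Arr C \<and> Dom C c = Cod C f \<and> c \<cdot>\<^bsub>C\<^esub> f = c \<cdot>\<^bsub>C\<^esub> g \<and>
    (\<forall>W. \<forall>h \<in> hom C (Cod C f) W. h \<cdot>\<^bsub>C\<^esub> f = h \<cdot>\<^bsub>C\<^esub> g \<longrightarrow>
      (\<exists>!h'. h' \<in> hom C (Cod C c) W \<and> h' \<cdot>\<^bsub>C\<^esub> c = h))"

text \<open>In \<open>is_pullback C f g p q\<close> the arrow \<open>p\<close> is the projection to \<open>Dom f\<close> and \<open>q\<close> the
  projection to \<open>Dom g\<close>, so that \<open>f \<cdot> p = g \<cdot> q\<close>.\<close>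

definition is_pullback ::
  "('o, 'm, 'x) cat_scheme \<Rightarrow> 'm \<Rightarrow> 'm \<Rightarrow> 'm \<Rightarrow> 'm \<Rightarrow> bool" where
  "is_pullback C f g p q \<longleftrightarrow>
    f \<in> Arr C \<and> g \<in> Arr C \<and> Cod C f = Cod C g \<and>
    p \<in> hom C (Dom C p) (Dom C f) \<and> q \<in> hom C (Dom C p) (Dom C g) \<and>
    f \<cdot>\<^bsub>C\<^esub> p = g \<cdot>\<^bsub>C\<^esub> q \<and>
    (\<forall>W. \<forall>a \<in> hom C W (Dom C f). \<forall>b \<in> hom C W (Dom C g). f \<cdot>\<^bsub>C\<^esub> a = g \<cdot>\<^bsub>C\<^esub> b \<longrightarrow>
      (\<exists>!h. h \<in> hom C W (Dom C p) \<and> p \<cdot>\<^bsub>C\<^esub> h = a \<and> q \<cdot>\<^bsub>C\<^esub> h = b))"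

definition is_kernel :: "('o, 'm, 'x) cat_scheme \<Rightarrow> 'm \<Rightarrow> 'm \<Rightarrow> bool" where
  "is_kernel C f k \<longleftrightarrow> f \<in> Arr C \<and> k \<in> Arr C \<and> Cod C k = Dom C f \<and>
    f \<cdot>\<^bsub>C\<^esub> k = \<zero>\<^bsub>C\<^esub> (Dom C k) (Cod C f) \<and>
    (\<forall>W. \<forall>h \<in> hom C W (Dom C f). f \<cdot>\<^bsub>C\<^esub> h = \<zero>\<^bsub>C\<^esub> W (Cod C f) \<longrightarrow>
      (\<exists>!h'. h' \<in> hom C W (Dom C k) \<and> k \<cdot>\<^bsub>C\<^esub> h' = h))"

definition finitely_complete :: "('o, 'm, 'x) cat_scheme \<Rightarrow> bool" where
  "finitely_complete C \<longleftrightarrow>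
    (\<exists>T. is_terminal C T) \<and>
    (\<forall>A \<in> Obj C. \<forall>B \<in> Obj C. \<exists>Q p1 p2. is_product C A B Q p1 p2) \<and>
    (\<forall>A B. \<forall>f \<in> hom C A B. \<forall>g \<in> hom C A B. \<exists>e. is_equalizer C f g e)"

section \<open>Regular categories\<close>

definition regular_epi :: "('o, 'm, 'x) cat_scheme \<Rightarrow> 'm \<Rightarrow> bool" where
  "regular_epi C c \<longleftrightarrow>
    (\<exists>A B. \<exists>f \<in> hom C A B. \<exists>g \<in> hom C A B. is_coequalizer C f g c)"

definition regular :: "('o, 'm, 'x) cat_scheme \<Rightarrow> bool" where
  "regular C \<longleftrightarrow> finitely_complete C \<and>
    (\<forall>f p q. is_pullback C f f p q \<longrightarrow> (\<exists>c. is_coequalizer C p q c)) \<and>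
    (\<forall>f g p q. is_pullback C f g p q \<longrightarrow> regular_epi C f \<longrightarrow> regular_epi C q)"

section \<open>Chosen binary products and coproducts\<close>

record ('o, 'm) bicat = "('o, 'm) cat" +
  Prod :: "'o \<Rightarrow> 'o \<Rightarrow> 'o"
  Pr1 :: "'o \<Rightarrow> 'o \<Rightarrow> 'm"
  Pr2 :: "'o \<Rightarrow> 'o \<Rightarrow> 'm"
  Coprod :: "'o \<Rightarrow> 'o \<Rightarrow> 'o"
  In1 :: "'o \<Rightarrow> 'o \<Rightarrow> 'm"
  In2 :: "'o \<Rightarrow> 'o \<Rightarrow> 'm"

definition chosen_products :: "('o, 'm, 'x) bicat_scheme \<Rightarrow> bool" where
  "chosen_products C \<longleftrightarrow>
    (\<forall>A \<in> Obj C. \<forall>B \<in> Obj C. is_product C A B (Prod C A B) (Pr1 C A B) (Pr2 C A B))"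

definition chosen_coproducts :: "('o, 'm, 'x) bicat_scheme \<Rightarrow> bool" where
  "chosen_coproducts C \<longleftrightarrow>
    (\<forall>A \<in> Obj C. \<forall>B \<in> Obj C. is_coproduct C A B (Coprod C A B) (In1 C A B) (In2 C A B))"

definition pairing :: "('o, 'm, 'x) bicat_scheme \<Rightarrow> 'm \<Rightarrow> 'm \<Rightarrow> 'm" ("\<langle>_,_\<rangle>\<index>") where
  "\<langle>f,g\<rangle>\<^bsub>C\<^esub> =
    (THE h. h \<in> hom C (Dom C f) (Prod C (Cod C f) (Cod C g)) \<and>
      Pr1 C (Cod C f) (Cod C g) \<cdot>\<^bsub>C\<^esub> h = f \<and> Pr2 C (Cod C f) (Cod C g) \<cdot>\<^bsub>C\<^esub> h = g)"

definition copairing :: "('o, 'm, 'x) bicat_scheme \<Rightarrow> 'm \<Rightarrow> 'm \<Rightarrow> 'm" ("\<lblot>_,_\<rblot>\<index>") where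
  "\<lblot>f,g\<rblot>\<^bsub>C\<^esub> =
    (THE h. h \<in> hom C (Coprod C (Dom C f) (Dom C g)) (Cod C f) \<and>
      h \<cdot>\<^bsub>C\<^esub> In1 C (Dom C f) (Dom C g) = f \<and> h \<cdot>\<^bsub>C\<^esub> In2 C (Dom C f) (Dom C g) = g)"

definition prod_arr :: "('o, 'm, 'x) bicat_scheme \<Rightarrow> 'm \<Rightarrow> 'm \<Rightarrow> 'm" where
  "prod_arr C f g =
    \<langle>f \<cdot>\<^bsub>C\<^esub> Pr1 C (Dom C f) (Dom C g), g \<cdot>\<^bsub>C\<^esub> Pr2 C (Dom C f) (Dom C g)\<rangle>\<^bsub>C\<^esub>"

definition coprod_arr :: "('o, 'm, 'x) bicat_scheme \<Rightarrow> 'm \<Rightarrow> 'm \<Rightarrow> 'm" where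
  "coprod_arr C f g =
    \<lblot>In1 C (Cod C f) (Cod C g) \<cdot>\<^bsub>C\<^esub> f, In2 C (Cod C f) (Cod C g) \<cdot>\<^bsub>C\<^esub> g\<rblot>\<^bsub>C\<^esub>"

definition prod_assoc :: "('o, 'm, 'x) bicat_scheme \<Rightarrow> 'o \<Rightarrow> 'o \<Rightarrow> 'o \<Rightarrow> 'm" where
  "prod_assoc C A B D =
    \<langle>Pr1 C A B \<cdot>\<^bsub>C\<^esub> Pr1 C (Prod C A B) D,
     \<langle>Pr2 C A B \<cdot>\<^bsub>C\<^esub> Pr1 C (Prod C A B) D, Pr2 C (Prod C A B) D\<rangle>\<^bsub>C\<^esub>\<rangle>\<^bsub>C\<^esub>"

definition comparison :: "('o, 'm, 'x) bicat_scheme \<Rightarrow> 'o \<Rightarrow> 'o \<Rightarrow> 'm" where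
  "comparison C A B =
    \<langle>\<lblot>\<one>\<^bsub>C\<^esub> A, \<zero>\<^bsub>C\<^esub> B A\<rblot>\<^bsub>C\<^esub>, \<lblot>\<zero>\<^bsub>C\<^esub> A B, \<one>\<^bsub>C\<^esub> B\<rblot>\<^bsub>C\<^esub>\<rangle>\<^bsub>C\<^esub>"

section \<open>Unital categories\<close>

definition jointly_extremal_epi :: "('o, 'm, 'x) cat_scheme \<Rightarrow> 'm \<Rightarrow> 'm \<Rightarrow> bool" where
  "jointly_extremal_epi C f g \<longleftrightarrow> f \<in> Arr C \<and> g \<in> Arr C \<and> Cod C f = Cod C g \<and>
    (\<forall>m. monic C m \<longrightarrow> Cod C m = Cod C f \<longrightarrow>
      (\<exists>f' \<in> hom C (Dom C f) (Dom C m). m \<cdot>\<^bsub>C\<^esub> f' = f) \<longrightarrow>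
      (\<exists>g' \<in> hom C (Dom C g) (Dom C m). m \<cdot>\<^bsub>C\<^esub> g' = g) \<longrightarrow>
      isomorphism C m)"

definition unital :: "('o, 'm, 'x) bicat_scheme \<Rightarrow> bool" where
  "unital C \<longleftrightarrow> pointed C \<and> finitely_complete C \<and>
    (\<forall>A \<in> Obj C. \<forall>B \<in> Obj C.
      jointly_extremal_epi C \<langle>\<one>\<^bsub>C\<^esub> A, \<zero>\<^bsub>C\<^esub> A B\<rangle>\<^bsub>C\<^esub> \<langle>\<zero>\<^bsub>C\<^esub> B A, \<one>\<^bsub>C\<^esub> B\<rangle>\<^bsub>C\<^esub>)"

section \<open>Comonadic covers and imaginary morphisms\<close>

record ('o, 'm) comonad_data =
  FObj :: "'o \<Rightarrow> 'o"
  FArr :: "'m \<Rightarrow> 'm"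
  Comult :: "'o \<Rightarrow> 'm"
  Counit :: "'o \<Rightarrow> 'm"

locale comonad = category C
  for C :: "('o, 'm, 'x) cat_scheme" (structure) +
  fixes P :: "('o, 'm, 'y) comonad_data_scheme"
  assumes FObj_Obj: "A \<in> Obj C \<Longrightarrow> FObj P A \<in> Obj C"
    and FArr_hom: "f \<in> hom C A B \<Longrightarrow> FArr P f \<in> hom C (FObj P A) (FObj P B)"
    and FArr_Ide: "A \<in> Obj C \<Longrightarrow> FArr P (\<one> A) = \<one> (FObj P A)"
    and FArr_Comp: "f \<in> hom C A B \<Longrightarrow> g \<in> hom C B D \<Longrightarrow> FArr P (g \<cdot> f) = FArr P g \<cdot> FArr P f"
    and Comult_hom: "A \<in> Obj C \<Longrightarrow> Comult P A \<in> hom C (FObj P A) (FObj P (FObj P A))"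
    and Counit_hom: "A \<in> Obj C \<Longrightarrow> Counit P A \<in> hom C (FObj P A) A"
    and Comult_natural:
      "f \<in> hom C A B \<Longrightarrow> Comult P B \<cdot> FArr P f = FArr P (FArr P f) \<cdot> Comult P A"
    and Counit_natural: "f \<in> hom C A B \<Longrightarrow> Counit P B \<cdot> FArr P f = f \<cdot> Counit P A"
    and Counit_Comult: "A \<in> Obj C \<Longrightarrow> Counit P (FObj P A) \<cdot> Comult P A = \<one> (FObj P A)"
    and FArr_Counit_Comult: "A \<in> Obj C \<Longrightarrow> FArr P (Counit P A) \<cdot> Comult P A = \<one> (FObj P A)"
    and Comult_coassoc:
      "A \<in> Obj C \<Longrightarrow> Comult P (FObj P A) \<cdot> Comult P A = FArr P (Comult P A) \<cdot> Comult P A"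

definition comonadic_covers ::
  "('o, 'm, 'x) cat_scheme \<Rightarrow> ('o, 'm, 'y) comonad_data_scheme \<Rightarrow> bool" where
  "comonadic_covers C P \<longleftrightarrow> comonad C P \<and> (\<forall>A \<in> Obj C. regular_epi C (Counit P A))"

text \<open>An imaginary morphism \<open>X \<dashrightarrow> Y\<close> is an arrow in \<open>hom C (FObj P X) Y\<close>. Since \<open>X\<close> cannot
  be recovered from \<open>FObj P X\<close>, operations on imaginary morphisms take their (imaginary)
  domains as explicit arguments. A composite \<open>v \<circ> a\<close> with a real \<open>v\<close> on the left is \<open>v \<cdot> a\<close>,
  and a composite \<open>a \<circ> u\<close> with a real \<open>u\<close> on the right is \<open>a \<cdot> FArr P u\<close>.\<close>

definition im_of_real ::
  "('o, 'm, 'x) cat_scheme \<Rightarrow> ('o, 'm, 'y) comonad_data_scheme \<Rightarrow> 'm \<Rightarrow> 'm" where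
  "im_of_real C P f = f \<cdot>\<^bsub>C\<^esub> Counit P (Dom C f)"

text \<open>\<open>im_comp C P A b a\<close> is the Kleisli composite \<open>b \<circ> a\<close> of \<open>a : A \<dashrightarrow> B\<close> and
  \<open>b : B \<dashrightarrow> D\<close>.\<close>

definition im_comp ::
  "('o, 'm, 'x) cat_scheme \<Rightarrow> ('o, 'm, 'y) comonad_data_scheme \<Rightarrow> 'o \<Rightarrow> 'm \<Rightarrow> 'm \<Rightarrow> 'm" where
  "im_comp C P A b a = b \<cdot>\<^bsub>C\<^esub> FArr P a \<cdot>\<^bsub>C\<^esub> Comult P A"

text \<open>\<open>im_prod C P A B a b\<close> is \<open>a \<times> b : A \<times> B \<dashrightarrow> A' \<times> B'\<close> for \<open>a : A \<dashrightarrow> A'\<close> and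
  \<open>b : B \<dashrightarrow> B'\<close>.\<close>

definition im_prod ::
  "('o, 'm, 'x) bicat_scheme \<Rightarrow> ('o, 'm, 'y) comonad_data_scheme \<Rightarrow> 'o \<Rightarrow> 'o \<Rightarrow> 'm \<Rightarrow> 'm \<Rightarrow> 'm"
  where
  "im_prod C P A B a b =
    \<langle>a \<cdot>\<^bsub>C\<^esub> FArr P (Pr1 C A B), b \<cdot>\<^bsub>C\<^esub> FArr P (Pr2 C A B)\<rangle>\<^bsub>C\<^esub>"

definition natural_imaginary_splitting ::
  "('o, 'm, 'x) bicat_scheme \<Rightarrow> ('o, 'm, 'y) comonad_data_scheme \<Rightarrow> ('o \<Rightarrow> 'o \<Rightarrow> 'm) \<Rightarrow> bool"
  where
  "natural_imaginary_splitting C P t \<longleftrightarrow>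
    (\<forall>A \<in> Obj C. \<forall>B \<in> Obj C. t A B \<in> hom C (FObj P (Prod C A B)) (Coprod C A B)) \<and>
    (\<forall>A A' B B'. \<forall>f \<in> hom C A A'. \<forall>g \<in> hom C B B'.
      t A' B' \<cdot>\<^bsub>C\<^esub> FArr P (prod_arr C f g) = coprod_arr C f g \<cdot>\<^bsub>C\<^esub> t A B) \<and>
    (\<forall>A \<in> Obj C. \<forall>B \<in> Obj C. comparison C A B \<cdot>\<^bsub>C\<^esub> t A B = Counit P (Prod C A B))"

definition im_add :: "('o, 'm, 'x) bicat_scheme \<Rightarrow> ('o \<Rightarrow> 'o \<Rightarrow> 'm) \<Rightarrow> 'o \<Rightarrow> 'm" where
  "im_add C t X = \<lblot>\<one>\<^bsub>C\<^esub> X, \<one>\<^bsub>C\<^esub> X\<rblot>\<^bsub>C\<^esub> \<cdot>\<^bsub>C\<^esub> t X X"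

text \<open>Here \<open>X \<times> X \<times> X\<close> is read as \<open>(X \<times> X) \<times> X\<close>, and the right-hand side, whose domain is
  \<open>X \<times> (X \<times> X)\<close>, is transported along the canonical isomorphism.\<close>

definition im_add_associative ::
  "('o, 'm, 'x) bicat_scheme \<Rightarrow> ('o, 'm, 'y) comonad_data_scheme \<Rightarrow> ('o \<Rightarrow> 'o \<Rightarrow> 'm) \<Rightarrow> bool"
  where
  "im_add_associative C P t \<longleftrightarrow>
    (\<forall>X \<in> Obj C.
      im_comp C P (Prod C (Prod C X X) X) (im_add C t X)
        (im_prod C P (Prod C X X) X (im_add C t X) (im_of_real C P (\<one>\<^bsub>C\<^esub> X)))
      = im_comp C P (Prod C X (Prod C X X)) (im_add C t X)
          (im_prod C P X (Prod C X X) (im_of_real C P (\<one>\<^bsub>C\<^esub> X)) (im_add C t X))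
        \<cdot>\<^bsub>C\<^esub> FArr P (prod_assoc C X X X))"

section \<open>Points\<close>

definition points :: "('o, 'm, 'x) cat_scheme \<Rightarrow> ('m \<times> 'm) set" where
  "points C = {(f, s). f \<in> Arr C \<and> s \<in> hom C (Cod C f) (Dom C f) \<and>
    f \<cdot>\<^bsub>C\<^esub> s = \<one>\<^bsub>C\<^esub> (Cod C f)}"

definition intrinsic_schreier ::
  "('o, 'm, 'x) bicat_scheme \<Rightarrow> ('o, 'm, 'y) comonad_data_scheme \<Rightarrow> ('o \<Rightarrow> 'o \<Rightarrow> 'm) \<Rightarrow>
    ('m \<times> 'm) set" where
  "intrinsic_schreier C P t = {(f, s) \<in> points C.
    \<exists>k q. is_kernel C f k \<and> q \<in> hom C (FObj P (Dom C f)) (Dom C k) \<and>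
      im_comp C P (Dom C f) (im_add C t (Dom C f))
        \<langle>k \<cdot>\<^bsub>C\<^esub> q, im_of_real C P (s \<cdot>\<^bsub>C\<^esub> f)\<rangle>\<^bsub>C\<^esub> = im_of_real C P (\<one>\<^bsub>C\<^esub> (Dom C f)) \<and>
      im_comp C P (Prod C (Dom C k) (Cod C f)) q
        (im_add C t (Dom C f) \<cdot>\<^bsub>C\<^esub> FArr P (prod_arr C k s))
        = im_of_real C P (Pr1 C (Dom C k) (Cod C f))}"

definition pullback_stable :: "('o, 'm, 'x) cat_scheme \<Rightarrow> ('m \<times> 'm) set \<Rightarrow> bool" where
  "pullback_stable C S \<longleftrightarrow>
    (\<forall>(f, s) \<in> S. \<forall>g p f' s'.
      is_pullback C f g p f' \<and> s' \<in> hom C (Cod C f') (Dom C f') \<and>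
      p \<cdot>\<^bsub>C\<^esub> s' = s \<cdot>\<^bsub>C\<^esub> g \<and> f' \<cdot>\<^bsub>C\<^esub> s' = \<one>\<^bsub>C\<^esub> (Cod C f')
      \<longrightarrow> (f', s') \<in> S)"

definition equivalence_relation ::
  "('o, 'm, 'x) bicat_scheme \<Rightarrow> 'o \<Rightarrow> 'o \<Rightarrow> 'm \<Rightarrow> 'm \<Rightarrow> bool" where
  "equivalence_relation C X R r1 r2 \<longleftrightarrow>
    r1 \<in> hom C R X \<and> r2 \<in> hom C R X \<and> monic C \<langle>r1,r2\<rangle>\<^bsub>C\<^esub> \<and>
    (\<exists>e \<in> hom C X R. r1 \<cdot>\<^bsub>C\<^esub> e = \<one>\<^bsub>C\<^esub> X \<and> r2 \<cdot>\<^bsub>C\<^esub> e = \<one>\<^bsub>C\<^esub> X) \<and>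
    (\<exists>i \<in> hom C R R. r1 \<cdot>\<^bsub>C\<^esub> i = r2 \<and> r2 \<cdot>\<^bsub>C\<^esub> i = r1) \<and>
    (\<exists>p q. is_pullback C r2 r1 p q \<and>
      (\<exists>m \<in> hom C (Dom C p) R. r1 \<cdot>\<^bsub>C\<^esub> m = r1 \<cdot>\<^bsub>C\<^esub> p \<and> r2 \<cdot>\<^bsub>C\<^esub> m = r2 \<cdot>\<^bsub>C\<^esub> q))"

text \<open>Equi-consistency is a property of pullback-stable classes of points only, hence the first
  two conjuncts. The data \<open>f''\<close>, \<open>s''\<close> are determined by the two equations for them.\<close>

definition equi_consistent :: "('o, 'm, 'x) bicat_scheme \<Rightarrow> ('m \<times> 'm) set \<Rightarrow> bool" where
  "equi_consistent C \<S> \<longleftrightarrow> \<S> \<subseteq> points C \<and> pullback_stable C \<S> \<and>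
    (\<forall>X Y R S f s r1 r2 s1 s2 eR eS f' s' X'' Y'' u v f'' s''.
      f \<in> hom C X Y \<and> (f, s) \<in> points C \<and>
      equivalence_relation C X R r1 r2 \<and> equivalence_relation C Y S s1 s2 \<and>
      eR \<in> hom C X R \<and> r1 \<cdot>\<^bsub>C\<^esub> eR = \<one>\<^bsub>C\<^esub> X \<and> r2 \<cdot>\<^bsub>C\<^esub> eR = \<one>\<^bsub>C\<^esub> X \<and>
      eS \<in> hom C Y S \<and> s1 \<cdot>\<^bsub>C\<^esub> eS = \<one>\<^bsub>C\<^esub> Y \<and> s2 \<cdot>\<^bsub>C\<^esub> eS = \<one>\<^bsub>C\<^esub> Y \<and>
      f' \<in> hom C R S \<and> (f', s') \<in> points C \<and>
      s1 \<cdot>\<^bsub>C\<^esub> f' = f \<cdot>\<^bsub>C\<^esub> r1 \<and> s2 \<cdot>\<^bsub>C\<^esub> f' = f \<cdot>\<^bsub>C\<^esub> r2 \<and>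
      r1 \<cdot>\<^bsub>C\<^esub> s' = s \<cdot>\<^bsub>C\<^esub> s1 \<and> r2 \<cdot>\<^bsub>C\<^esub> s' = s \<cdot>\<^bsub>C\<^esub> s2 \<and>
      f' \<cdot>\<^bsub>C\<^esub> eR = eS \<cdot>\<^bsub>C\<^esub> f \<and> s' \<cdot>\<^bsub>C\<^esub> eS = eR \<cdot>\<^bsub>C\<^esub> s \<and>
      u \<in> hom C X'' R \<and> is_kernel C r1 u \<and> v \<in> hom C Y'' S \<and> is_kernel C s1 v \<and>
      f'' \<in> hom C X'' Y'' \<and> (f'', s'') \<in> points C \<and>
      v \<cdot>\<^bsub>C\<^esub> f'' = f' \<cdot>\<^bsub>C\<^esub> u \<and> u \<cdot>\<^bsub>C\<^esub> s'' = s' \<cdot>\<^bsub>C\<^esub> v \<and>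
      (f, s) \<in> \<S> \<and> (r1, eR) \<in> \<S> \<and> (f'', s'') \<in> \<S>
      \<longrightarrow> (f', s') \<in> \<S>)"

end

theory Submission
  imports Defs
begin

text \<open>Fix an object \<open>W\<close> and regard imaginary morphisms \<open>W \<dashrightarrow> X\<close> as elements of \<open>X\<close>. The
  imaginary addition turns them into a monoid \<open>X(W)\<close> under \<open>a + b = \<mu> \<circ> \<langle>a,b\<rangle>\<close>: zero is
  neutral because \<open>r t = \<epsilon>\<close> (\<open>im_plus_zero\<close>, \<open>zero_im_plus\<close>), and associativity of the natural
  addition is associativity of these sums (\<open>im_plus_assoc\<close>). Real morphisms act as monoid
  homomorphisms because \<open>t\<close> is natural (\<open>comp_im_plus\<close>), and
  \<open>X \<mapsto> X(W)\<close> preserves limits.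

  Under this translation a split epimorphism \<open>(f, s)\<close> is intrinsic Schreier if and only if, for
  all \<open>W\<close>, every \<open>x\<close> in \<open>X(W)\<close> is \<open>a + s f x\<close> with \<open>f a = 0\<close>, and \<open>s b\<close> can be cancelled on the
  right between such \<open>a\<close>: the retraction \<open>q\<close> is the factorization through the kernel of the
  solution \<open>a\<close> for the universal element \<open>\<epsilon>\<close> of \<open>X\<close>. This is the notion of a Schreier split epimorphism of monoids,
  so that stability under pullback and equi-consistency become statements about monoids.

  For equi-consistency, read elements of the relation \<open>R\<close> as pairs \<open>\<rho> = (x,y)\<close>. The kernel of
  \<open>r\<^sub>1\<close> is a group: by symmetry of \<open>R\<close>, with \<open>(0,y)\<close> also \<open>(y,0)\<close> lies in \<open>R\<close>, and its
  decomposition \<open>(y,0) = (0,n) + (y,y)\<close> exhibits \<open>(0,n)\<close> as a left inverse of \<open>(0,y)\<close>. Now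
  decompose \<open>\<rho> = z + e x\<close> with \<open>z\<close> in that group, \<open>e\<close> being reflexivity, and then
  \<open>x = c + s f x\<close>. As \<open>w = s' f' z\<close> belongs to the group,
    \<open>\<rho> = (z + e c + (-w)) + (w + e s f x)\<close>,
  where the first bracket is annihilated by \<open>f'\<close> and the second equals \<open>s' f' \<rho>\<close>. This is the
  decomposition required of \<open>f'\<close>. Cancellation for \<open>f'\<close> follows from cancellation for \<open>f\<close>, for
  \<open>r\<^sub>1\<close>, and in the group.\<close>

section \<open>Calculating in a pointed category\<close>

context category
begin

lemma hom_iff: "f \<in> hom C A B \<longleftrightarrow> f \<in> Arr C \<and> Dom C f = A \<and> Cod C f = B"
  by (auto simp: hom_def)

lemma Dom_Cod_Obj [simp]:
  assumes "f \<in> Arr C"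
  shows "Dom C f \<in> Obj C" "Cod C f \<in> Obj C"
  using assms Dom_Obj Cod_Obj by auto

lemma Ide_simps [simp]:
  assumes "A \<in> Obj C"
  shows "\<one> A \<in> Arr C" "Dom C (\<one> A) = A" "Cod C (\<one> A) = A"
  using Ide_hom[OF assms] by (auto simp: hom_iff)

text \<open>With domains and codomains as equations instead of membership in \<open>hom\<close>, the simplifier can
  discharge all composability conditions by itself.\<close>

lemma Comp_simps [simp]:
  assumes "f \<in> Arr C" "g \<in> Arr C" "Dom C g = Cod C f"
  shows "g \<cdot> f \<in> Arr C" "Dom C (g \<cdot> f) = Dom C f" "Cod C (g \<cdot> f) = Cod C g"
  using Comp_hom[of f "Dom C f" "Cod C f" g "Cod C g"] assms by (auto simp: hom_iff)

lemma Ide_units [simp]: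
  assumes "f \<in> Arr C"
  shows "Dom C f = A \<Longrightarrow> f \<cdot> \<one> A = f" "Cod C f = B \<Longrightarrow> \<one> B \<cdot> f = f"
  using Comp_Ide[of f "Dom C f" "Cod C f"] Ide_Comp[of f "Dom C f" "Cod C f"] assms
  by (auto simp: hom_iff)

lemma assoc [simp]:
  assumes "f \<in> Arr C" "g \<in> Arr C" "h \<in> Arr C" "Dom C g = Cod C f" "Dom C h = Cod C g"
  shows "(h \<cdot> g) \<cdot> f = h \<cdot> (g \<cdot> f)"
  using Comp_assoc[of f "Dom C f" "Cod C f" g "Cod C g" h "Cod C h"] assms by (auto simp: hom_iff)

text \<open>An equation between composites may be applied inside a longer, right-nested composite.\<close>

lemma comp_cong:
  assumes "g \<cdot> f = g' \<cdot> f'"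
    and "f \<in> Arr C" "g \<in> Arr C" "Dom C g = Cod C f"
    and "f' \<in> Arr C" "g' \<in> Arr C" "Dom C g' = Cod C f'"
    and "x \<in> Arr C" "Cod C x = Dom C f" "Cod C x = Dom C f'"
  shows "g \<cdot> (f \<cdot> x) = g' \<cdot> (f' \<cdot> x)"
  using assms by (metis assoc)

lemma comp_cong_Ide:
  assumes "g \<cdot> f = \<one> A"
    and "f \<in> Arr C" "g \<in> Arr C" "Dom C g = Cod C f" "Dom C f = A"
    and "x \<in> Arr C" "Cod C x = A"
  shows "g \<cdot> (f \<cdot> x) = x"
  using assms by (metis assoc Ide_units(2))

text \<open>Two zero objects are linked by a unique arrow, and inserting it turns one factorization
  through a zero object into the other.\<close>

lemma zero_arr_eq:
  assumes Z: "is_zero_object C Z" and u: "u \<in> hom C A Z" and v: "v \<in> hom C Z B"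
  shows "\<zero> A B = v \<cdot> u"
  unfolding zero_arr_def
proof (rule the_equality)
  show "\<exists>Z. is_zero_object C Z \<and> (\<exists>u'\<in>hom C A Z. \<exists>v'\<in>hom C Z B. v \<cdot> u = v' \<cdot> u')"
    using assms by blast
next
  fix z
  assume "\<exists>Z. is_zero_object C Z \<and> (\<exists>u\<in>hom C A Z. \<exists>v\<in>hom C Z B. z = v \<cdot> u)"
  then obtain Z' u' v' where Z': "is_zero_object C Z'"
    and u': "u' \<in> hom C A Z'" and v': "v' \<in> hom C Z' B" and z: "z = v' \<cdot> u'"
    by blast
  have A: "A \<in> Obj C" and B: "B \<in> Obj C"
    using u v by (auto simp: hom_iff)
  obtain w where w: "w \<in> hom C Z Z'"
    using Z Z' unfolding is_zero_object_def is_initial_def by blast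
  have "v' \<cdot> w \<in> hom C Z B"
    using w v' by (auto simp: hom_iff)
  then have "v' \<cdot> w = v"
    using Z v B unfolding is_zero_object_def is_initial_def by blast
  moreover have "w \<cdot> u \<in> hom C A Z'"
    using w u by (auto simp: hom_iff)
  then have "w \<cdot> u = u'"
    using Z' u' A unfolding is_zero_object_def is_terminal_def by blast
  moreover have "(v' \<cdot> w) \<cdot> u = v' \<cdot> (w \<cdot> u)"
    using u w v' by (auto simp: hom_iff)
  ultimately show "z = v \<cdot> u"
    using z by simp
qed

end

locale pointed_category = category C
  for C :: "('o, 'm, 'x) cat_scheme" (structure) +
  assumes pointed: "pointed C"
begin

lemma zero_factors:
  assumes "A \<in> Obj C" "B \<in> Obj C"
  obtains Z u v where "is_zero_object C Z" "u \<in> hom C A Z" "v \<in> hom C Z B" "\<zero> A B = v \<cdot> u"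
proof -
  obtain Z where Z: "is_zero_object C Z"
    using pointed unfolding pointed_def by blast
  moreover obtain u where u: "u \<in> hom C A Z"
    using Z assms(1) unfolding is_zero_object_def is_terminal_def by blast
  moreover obtain v where v: "v \<in> hom C Z B"
    using Z assms(2) unfolding is_zero_object_def is_initial_def by blast
  ultimately show ?thesis
    using that zero_arr_eq by blast
qed

lemma zero_simps [simp]:
  assumes "A \<in> Obj C" "B \<in> Obj C"
  shows "\<zero> A B \<in> Arr C" "Dom C (\<zero> A B) = A" "Cod C (\<zero> A B) = B"
  using zero_factors[OF assms] Comp_hom by (metis hom_iff)+

lemma comp_zero [simp]:
  assumes "A \<in> Obj C" "g \<in> Arr C" "Dom C g = B"
  shows "g \<cdot> \<zero> A B = \<zero> A (Cod C g)"
proof -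
  have "B \<in> Obj C"
    using assms by auto
  then obtain Z u v where Z: "is_zero_object C Z" and u: "u \<in> hom C A Z" and v: "v \<in> hom C Z B"
    and z: "\<zero> A B = v \<cdot> u"
    using zero_factors[OF assms(1)] by blast
  have "g \<cdot> v \<in> hom C Z (Cod C g)"
    using v assms by (auto simp: hom_iff)
  then have "\<zero> A (Cod C g) = (g \<cdot> v) \<cdot> u"
    using zero_arr_eq Z u by blast
  then show ?thesis
    using z u v assms by (auto simp: hom_iff)
qed

lemma zero_comp [simp]:
  assumes "B \<in> Obj C" "g \<in> Arr C" "Cod C g = A"
  shows "\<zero> A B \<cdot> g = \<zero> (Dom C g) B"
proof -
  have "A \<in> Obj C"
    using assms by auto
  then obtain Z u v where Z: "is_zero_object C Z" and u: "u \<in> hom C A Z" and v: "v \<in> hom C Z B"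
    and z: "\<zero> A B = v \<cdot> u"
    using zero_factors[OF _ assms(1)] by blast
  have "u \<cdot> g \<in> hom C (Dom C g) Z"
    using u assms by (auto simp: hom_iff)
  then have "\<zero> (Dom C g) B = v \<cdot> (u \<cdot> g)"
    using zero_arr_eq Z v by blast
  then show ?thesis
    using z u v assms by (auto simp: hom_iff)
qed

lemma kernel_exists:
  assumes "finitely_complete C" "f \<in> Arr C"
  obtains k where "is_kernel C f k"
proof -
  have "f \<in> hom C (Dom C f) (Cod C f)" "\<zero> (Dom C f) (Cod C f) \<in> hom C (Dom C f) (Cod C f)"
    using assms(2) by (auto simp: hom_iff)
  then obtain k where k: "is_equalizer C f (\<zero> (Dom C f) (Cod C f)) k"
    using assms(1) unfolding finitely_complete_def by blast
  have "is_kernel C f k"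
    unfolding is_kernel_def
  proof (intro conjI allI ballI impI)
    show "f \<in> Arr C" "k \<in> Arr C" "Cod C k = Dom C f" "f \<cdot> k = \<zero> (Dom C k) (Cod C f)"
      using k assms(2) by (auto simp: is_equalizer_def)
  next
    fix W h
    assume h: "h \<in> hom C W (Dom C f)" and fh: "f \<cdot> h = \<zero> W (Cod C f)"
    have "\<zero> (Dom C f) (Cod C f) \<cdot> h = \<zero> W (Cod C f)"
      using h assms(2) by (auto simp: hom_iff)
    then show "\<exists>!h'. h' \<in> hom C W (Dom C k) \<and> k \<cdot> h' = h"
      using k h fh unfolding is_equalizer_def by auto
  qed
  then show ?thesis
    using that by blast
qed

lemma kernel_factors:
  assumes "is_kernel C f k" "h \<in> Arr C" "Cod C h = Dom C f" "f \<cdot> h = \<zero> (Dom C h) (Cod C f)"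
  obtains h' where "h' \<in> Arr C" "Dom C h' = Dom C h" "Cod C h' = Dom C k" "k \<cdot> h' = h"
proof -
  have "h \<in> hom C (Dom C h) (Dom C f)"
    using assms by (simp add: hom_iff)
  then have "\<exists>!h'. h' \<in> hom C (Dom C h) (Dom C k) \<and> k \<cdot> h' = h"
    using assms(1,4) unfolding is_kernel_def by blast
  then show ?thesis
    using that unfolding hom_iff by blast
qed

lemma kernel_monic:
  assumes "is_kernel C f k" "a \<in> Arr C" "b \<in> Arr C" "Dom C b = Dom C a"
    and "Cod C a = Dom C k" "Cod C b = Dom C k" "k \<cdot> a = k \<cdot> b"
  shows "a = b"
proof -
  have k: "f \<in> Arr C" "k \<in> Arr C" "Cod C k = Dom C f" "f \<cdot> k = \<zero> (Dom C k) (Cod C f)"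
    using assms(1) by (auto simp: is_kernel_def)
  have "f \<cdot> (k \<cdot> a) = (f \<cdot> k) \<cdot> a"
    using k(1-3) assms(2,5) by simp
  also have "\<dots> = \<zero> (Dom C a) (Cod C f)"
    unfolding k(4) using k(1,2) assms(2,5) by simp
  finally have "f \<cdot> (k \<cdot> a) = \<zero> (Dom C a) (Cod C f)" .
  moreover have "k \<cdot> a \<in> hom C (Dom C a) (Dom C f)"
    using k assms by (simp add: hom_iff)
  ultimately have "\<exists>!h'. h' \<in> hom C (Dom C a) (Dom C k) \<and> k \<cdot> h' = k \<cdot> a"
    using assms(1) unfolding is_kernel_def by blast
  then show ?thesis
    using assms(2-) by (metis hom_iff)
qed

end

section \<open>Products, coproducts and Kleisli composition\<close>

locale imaginary_addition = comonad C P + pointed_category C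
  for C :: "('o, 'm, 'x) bicat_scheme" (structure)
    and P :: "('o, 'm, 'y) comonad_data_scheme" +
  fixes t :: "'o \<Rightarrow> 'o \<Rightarrow> 'm"
  assumes products: "chosen_products C"
    and coproducts: "chosen_coproducts C"
    and splitting: "natural_imaginary_splitting C P t"
    and associative: "im_add_associative C P t"
begin

lemma Prod_simps [simp]:
  assumes "A \<in> Obj C" "B \<in> Obj C"
  shows "Prod C A B \<in> Obj C"
    "Pr1 C A B \<in> Arr C" "Dom C (Pr1 C A B) = Prod C A B" "Cod C (Pr1 C A B) = A"
    "Pr2 C A B \<in> Arr C" "Dom C (Pr2 C A B) = Prod C A B" "Cod C (Pr2 C A B) = B"
proof -
  have "is_product C A B (Prod C A B) (Pr1 C A B) (Pr2 C A B)"
    using products assms by (simp add: chosen_products_def)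
  then show "Pr1 C A B \<in> Arr C" "Dom C (Pr1 C A B) = Prod C A B" "Cod C (Pr1 C A B) = A"
    "Pr2 C A B \<in> Arr C" "Dom C (Pr2 C A B) = Prod C A B" "Cod C (Pr2 C A B) = B"
    by (auto simp: is_product_def hom_iff)
  then show "Prod C A B \<in> Obj C"
    using Dom_Obj by metis
qed

lemma pairing_ex1:
  assumes "f \<in> Arr C" "g \<in> Arr C" "Dom C g = Dom C f"
  shows "\<exists>!h. h \<in> hom C (Dom C f) (Prod C (Cod C f) (Cod C g)) \<and>
    Pr1 C (Cod C f) (Cod C g) \<cdot> h = f \<and> Pr2 C (Cod C f) (Cod C g) \<cdot> h = g"
proof -
  have "is_product C (Cod C f) (Cod C g) (Prod C (Cod C f) (Cod C g))
      (Pr1 C (Cod C f) (Cod C g)) (Pr2 C (Cod C f) (Cod C g))"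
    using products assms by (simp add: chosen_products_def)
  moreover have "f \<in> hom C (Dom C f) (Cod C f)" "g \<in> hom C (Dom C f) (Cod C g)"
    using assms by (auto simp: hom_iff)
  ultimately show ?thesis
    unfolding is_product_def by blast
qed

lemma pairing_simps [simp]:
  assumes "f \<in> Arr C" "g \<in> Arr C" "Dom C g = Dom C f"
  shows "\<langle>f,g\<rangle> \<in> Arr C" "Dom C \<langle>f,g\<rangle> = Dom C f" "Cod C \<langle>f,g\<rangle> = Prod C (Cod C f) (Cod C g)"
    "Cod C f = A \<Longrightarrow> Cod C g = B \<Longrightarrow> Pr1 C A B \<cdot> \<langle>f,g\<rangle> = f"
    "Cod C f = A \<Longrightarrow> Cod C g = B \<Longrightarrow> Pr2 C A B \<cdot> \<langle>f,g\<rangle> = g"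
  using theI'[OF pairing_ex1[OF assms]] unfolding pairing_def[symmetric] by (auto simp: hom_iff)

lemma Prod_ext:
  assumes "h \<in> hom C W (Prod C A B)" "h' \<in> hom C W (Prod C A B)" "A \<in> Obj C" "B \<in> Obj C"
    and "Pr1 C A B \<cdot> h = Pr1 C A B \<cdot> h'" "Pr2 C A B \<cdot> h = Pr2 C A B \<cdot> h'"
  shows "h = h'"
proof -
  have "Pr1 C A B \<cdot> h \<in> hom C W A" "Pr2 C A B \<cdot> h \<in> hom C W B"
    using assms by (auto simp: hom_iff)
  then have "\<exists>!h''. h'' \<in> hom C W (Prod C A B) \<and>
      Pr1 C A B \<cdot> h'' = Pr1 C A B \<cdot> h \<and> Pr2 C A B \<cdot> h'' = Pr2 C A B \<cdot> h"
    using products assms(3,4) unfolding chosen_products_def is_product_def by blast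
  then show ?thesis
    using assms by metis
qed

lemma pairing_comp [simp]:
  assumes "f \<in> Arr C" "g \<in> Arr C" "Dom C g = Dom C f" "x \<in> Arr C" "Cod C x = Dom C f"
  shows "\<langle>f,g\<rangle> \<cdot> x = \<langle>f \<cdot> x, g \<cdot> x\<rangle>"
proof (rule Prod_ext)
  show "\<langle>f,g\<rangle> \<cdot> x \<in> hom C (Dom C x) (Prod C (Cod C f) (Cod C g))"
    "\<langle>f \<cdot> x, g \<cdot> x\<rangle> \<in> hom C (Dom C x) (Prod C (Cod C f) (Cod C g))"
    using assms by (auto simp: hom_iff)
  show "Pr1 C (Cod C f) (Cod C g) \<cdot> (\<langle>f,g\<rangle> \<cdot> x) = Pr1 C (Cod C f) (Cod C g) \<cdot> \<langle>f \<cdot> x, g \<cdot> x\<rangle>"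
    "Pr2 C (Cod C f) (Cod C g) \<cdot> (\<langle>f,g\<rangle> \<cdot> x) = Pr2 C (Cod C f) (Cod C g) \<cdot> \<langle>f \<cdot> x, g \<cdot> x\<rangle>"
    using assms by (simp_all flip: assoc)
qed (use assms in auto)

lemma prod_arr_simps [simp]:
  assumes "f \<in> Arr C" "g \<in> Arr C"
  shows "prod_arr C f g \<in> Arr C" "Dom C (prod_arr C f g) = Prod C (Dom C f) (Dom C g)"
    "Cod C (prod_arr C f g) = Prod C (Cod C f) (Cod C g)"
  using assms by (auto simp: prod_arr_def)

lemma prod_arr_pairing [simp]:
  assumes "f \<in> Arr C" "g \<in> Arr C" "a \<in> Arr C" "b \<in> Arr C" "Dom C b = Dom C a"
    and "Dom C f = Cod C a" "Dom C g = Cod C b"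
  shows "prod_arr C f g \<cdot> \<langle>a,b\<rangle> = \<langle>f \<cdot> a, g \<cdot> b\<rangle>"
  using assms by (simp add: prod_arr_def)

lemma Coprod_simps [simp]:
  assumes "A \<in> Obj C" "B \<in> Obj C"
  shows "Coprod C A B \<in> Obj C"
    "In1 C A B \<in> Arr C" "Dom C (In1 C A B) = A" "Cod C (In1 C A B) = Coprod C A B"
    "In2 C A B \<in> Arr C" "Dom C (In2 C A B) = B" "Cod C (In2 C A B) = Coprod C A B"
proof -
  have "is_coproduct C A B (Coprod C A B) (In1 C A B) (In2 C A B)"
    using coproducts assms by (simp add: chosen_coproducts_def)
  then show "In1 C A B \<in> Arr C" "Dom C (In1 C A B) = A" "Cod C (In1 C A B) = Coprod C A B"
    "In2 C A B \<in> Arr C" "Dom C (In2 C A B) = B" "Cod C (In2 C A B) = Coprod C A B"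
    by (auto simp: is_coproduct_def hom_iff)
  then show "Coprod C A B \<in> Obj C"
    using Cod_Obj by metis
qed

lemma copairing_ex1:
  assumes "f \<in> Arr C" "g \<in> Arr C" "Cod C g = Cod C f"
  shows "\<exists>!h. h \<in> hom C (Coprod C (Dom C f) (Dom C g)) (Cod C f) \<and>
    h \<cdot> In1 C (Dom C f) (Dom C g) = f \<and> h \<cdot> In2 C (Dom C f) (Dom C g) = g"
proof -
  have "is_coproduct C (Dom C f) (Dom C g) (Coprod C (Dom C f) (Dom C g))
      (In1 C (Dom C f) (Dom C g)) (In2 C (Dom C f) (Dom C g))"
    using coproducts assms by (simp add: chosen_coproducts_def)
  moreover have "f \<in> hom C (Dom C f) (Cod C f)" "g \<in> hom C (Dom C g) (Cod C f)"
    using assms by (auto simp: hom_iff)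
  ultimately show ?thesis
    unfolding is_coproduct_def by blast
qed

lemma copairing_simps [simp]:
  assumes "f \<in> Arr C" "g \<in> Arr C" "Cod C g = Cod C f"
  shows "\<lblot>f,g\<rblot> \<in> Arr C" "Dom C \<lblot>f,g\<rblot> = Coprod C (Dom C f) (Dom C g)" "Cod C \<lblot>f,g\<rblot> = Cod C f"
    "Dom C f = A \<Longrightarrow> Dom C g = B \<Longrightarrow> \<lblot>f,g\<rblot> \<cdot> In1 C A B = f"
    "Dom C f = A \<Longrightarrow> Dom C g = B \<Longrightarrow> \<lblot>f,g\<rblot> \<cdot> In2 C A B = g"
  using theI'[OF copairing_ex1[OF assms]] unfolding copairing_def[symmetric]
  by (auto simp: hom_iff)

lemma copairing_unique:
  assumes "f \<in> Arr C" "g \<in> Arr C" "Cod C g = Cod C f"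
    and "h \<in> hom C (Coprod C (Dom C f) (Dom C g)) (Cod C f)"
    and "h \<cdot> In1 C (Dom C f) (Dom C g) = f" "h \<cdot> In2 C (Dom C f) (Dom C g) = g"
  shows "h = \<lblot>f,g\<rblot>"
  using copairing_ex1[OF assms(1-3)] copairing_simps[OF assms(1-3)] assms(4-)
  by (metis hom_iff)

lemma comp_copairing [simp]:
  assumes "f \<in> Arr C" "g \<in> Arr C" "Cod C g = Cod C f" "x \<in> Arr C" "Dom C x = Cod C f"
  shows "x \<cdot> \<lblot>f,g\<rblot> = \<lblot>x \<cdot> f, x \<cdot> g\<rblot>"
  using assms by (intro copairing_unique) (auto simp: hom_iff)

lemma coprod_arr_simps [simp]:
  assumes "f \<in> Arr C" "g \<in> Arr C"
  shows "coprod_arr C f g \<in> Arr C"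
    "Dom C (coprod_arr C f g) = Coprod C (Dom C f) (Dom C g)"
    "Cod C (coprod_arr C f g) = Coprod C (Cod C f) (Cod C g)"
  using assms by (auto simp: coprod_arr_def)

lemma copairing_coprod_arr:
  assumes "f \<in> Arr C" "g \<in> Arr C" "a \<in> Arr C" "b \<in> Arr C" "Cod C b = Cod C a"
    and "Dom C a = Cod C f" "Dom C b = Cod C g"
  shows "\<lblot>a,b\<rblot> \<cdot> coprod_arr C f g = \<lblot>a \<cdot> f, b \<cdot> g\<rblot>"
  using assms by (simp add: coprod_arr_def flip: assoc)

lemma FObj_simps [simp]:
  assumes "A \<in> Obj C"
  shows "FObj P A \<in> Obj C"
    "Comult P A \<in> Arr C" "Dom C (Comult P A) = FObj P A" "Cod C (Comult P A) = FObj P (FObj P A)"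
    "Counit P A \<in> Arr C" "Dom C (Counit P A) = FObj P A" "Cod C (Counit P A) = A"
  using FObj_Obj[OF assms] Comult_hom[OF assms] Counit_hom[OF assms] by (auto simp: hom_iff)

lemma FArr_simps [simp]:
  assumes "f \<in> Arr C"
  shows "FArr P f \<in> Arr C" "Dom C (FArr P f) = FObj P (Dom C f)"
    "Cod C (FArr P f) = FObj P (Cod C f)"
  using FArr_hom[of f "Dom C f" "Cod C f"] assms by (auto simp: hom_iff)

lemma FArr_Comp' [simp]:
  assumes "f \<in> Arr C" "g \<in> Arr C" "Dom C g = Cod C f"
  shows "FArr P (g \<cdot> f) = FArr P g \<cdot> FArr P f"
  using FArr_Comp[of f "Dom C f" "Cod C f" g "Cod C g"] assms by (auto simp: hom_iff)

lemma im_comp_simps [simp]: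
  assumes "W \<in> Obj C" "x \<in> Arr C" "Dom C x = FObj P W" "a \<in> Arr C" "Dom C a = FObj P (Cod C x)"
  shows "im_comp C P W a x \<in> Arr C" "Dom C (im_comp C P W a x) = FObj P W"
    "Cod C (im_comp C P W a x) = Cod C a"
  using assms by (auto simp: im_comp_def)

lemma comp_im_comp:
  assumes "W \<in> Obj C" "x \<in> Arr C" "Dom C x = FObj P W" "a \<in> Arr C" "Dom C a = FObj P (Cod C x)"
    and "v \<in> Arr C" "Dom C v = Cod C a"
  shows "im_comp C P W (v \<cdot> a) x = v \<cdot> im_comp C P W a x"
  using assms by (simp add: im_comp_def)

lemma im_comp_FArr:
  assumes "W \<in> Obj C" "x \<in> Arr C" "Dom C x = FObj P W" "u \<in> Arr C" "Dom C u = Cod C x"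
    and "a \<in> Arr C" "Dom C a = FObj P (Cod C u)"
  shows "im_comp C P W (a \<cdot> FArr P u) x = im_comp C P W a (u \<cdot> x)"
  using assms by (simp add: im_comp_def)

lemma im_comp_Counit:
  assumes "W \<in> Obj C" "x \<in> Arr C" "Dom C x = FObj P W" "Cod C x = X"
  shows "im_comp C P W (Counit P X) x = x"
proof -
  have "im_comp C P W (Counit P X) x = (Counit P X \<cdot> FArr P x) \<cdot> Comult P W"
    by (simp add: im_comp_def)
  also have "Counit P X \<cdot> FArr P x = x \<cdot> Counit P (FObj P W)"
    using assms Counit_natural[of x "FObj P W" X] by (simp add: hom_iff)
  also have "\<dots> \<cdot> Comult P W = x \<cdot> (Counit P (FObj P W) \<cdot> Comult P W)"
    using assms by simp
  also have "\<dots> = x"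
    using assms Counit_Comult by simp
  finally show ?thesis .
qed

lemma im_comp_real:
  assumes "W \<in> Obj C" "x \<in> Arr C" "Dom C x = FObj P W" "v \<in> Arr C" "Dom C v = Cod C x"
  shows "im_comp C P W (v \<cdot> Counit P (Cod C x)) x = v \<cdot> x"
  using assms by (simp add: comp_im_comp im_comp_Counit)

lemma im_comp_assoc:
  assumes "V \<in> Obj C" "c \<in> Arr C" "Dom C c = FObj P V" "Cod C c = W"
    and "x \<in> Arr C" "Dom C x = FObj P W" "a \<in> Arr C" "Dom C a = FObj P (Cod C x)"
  shows "im_comp C P V (im_comp C P W a x) c = im_comp C P V a (im_comp C P V x c)"
proof -
  have W: "W \<in> Obj C"
    using assms by auto
  have nat: "Comult P W \<cdot> FArr P c = FArr P (FArr P c) \<cdot> Comult P (FObj P V)"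
    using Comult_natural[of c "FObj P V" W] assms by (simp add: hom_iff)
  have "im_comp C P V (im_comp C P W a x) c
      = a \<cdot> (FArr P x \<cdot> ((Comult P W \<cdot> FArr P c) \<cdot> Comult P V))"
    using assms W by (simp add: im_comp_def)
  also have "\<dots> = a \<cdot> (FArr P x \<cdot> (FArr P (FArr P c) \<cdot> (Comult P (FObj P V) \<cdot> Comult P V)))"
    using assms by (simp add: nat)
  also have "\<dots> = im_comp C P V a (im_comp C P V x c)"
    using assms W by (simp add: im_comp_def Comult_coassoc)
  finally show ?thesis .
qed

lemma pairing_im_comp:
  assumes "V \<in> Obj C" "c \<in> Arr C" "Dom C c = FObj P V"
    and "a \<in> Arr C" "Dom C a = FObj P (Cod C c)" "b \<in> Arr C" "Dom C b = FObj P (Cod C c)"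
  shows "im_comp C P V \<langle>a,b\<rangle> c = \<langle>im_comp C P V a c, im_comp C P V b c\<rangle>"
  using assms by (simp add: im_comp_def)

section \<open>The monoid of imaginary morphisms into an object\<close>

text \<open>The imaginary domain \<open>W\<close> is an explicit argument because it cannot be recovered from
  \<open>FObj P W\<close>.\<close>

definition im_plus :: "'m \<Rightarrow> 'o \<Rightarrow> 'm \<Rightarrow> 'm" ("_ \<oplus>\<^bsub>_\<^esub> _" [65, 0, 66] 65) where
  "a \<oplus>\<^bsub>W\<^esub> b = im_comp C P W (im_add C t (Cod C a)) \<langle>a,b\<rangle>"

abbreviation im_hom :: "'o \<Rightarrow> 'o \<Rightarrow> 'm set" where
  "im_hom W X \<equiv> hom C (FObj P W) X"

lemma t_simps [simp]:
  assumes "A \<in> Obj C" "B \<in> Obj C"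
  shows "t A B \<in> Arr C" "Dom C (t A B) = FObj P (Prod C A B)" "Cod C (t A B) = Coprod C A B"
  using splitting assms by (auto simp: natural_imaginary_splitting_def hom_iff)

lemma t_natural:
  assumes "f \<in> Arr C" "g \<in> Arr C"
  shows "t (Cod C f) (Cod C g) \<cdot> FArr P (prod_arr C f g)
    = coprod_arr C f g \<cdot> t (Dom C f) (Dom C g)"
proof -
  have "f \<in> hom C (Dom C f) (Cod C f)" "g \<in> hom C (Dom C g) (Cod C g)"
    using assms by (auto simp: hom_iff)
  then show ?thesis
    using splitting unfolding natural_imaginary_splitting_def by blast
qed

lemma comparison_t:
  assumes "A \<in> Obj C" "B \<in> Obj C"
  shows "comparison C A B \<cdot> t A B = Counit P (Prod C A B)"
  using splitting assms unfolding natural_imaginary_splitting_def by blast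

lemma im_add_simps [simp]:
  assumes "X \<in> Obj C"
  shows "im_add C t X \<in> Arr C" "Dom C (im_add C t X) = FObj P (Prod C X X)"
    "Cod C (im_add C t X) = X"
  using assms by (auto simp: im_add_def)

lemma im_add_FArr_prod_arr:
  assumes "f \<in> Arr C" "g \<in> Arr C" "Cod C f = Y" "Cod C g = Y"
  shows "im_add C t Y \<cdot> FArr P (prod_arr C f g) = \<lblot>f,g\<rblot> \<cdot> t (Dom C f) (Dom C g)"
proof -
  have Y: "Y \<in> Obj C"
    using assms by auto
  have "im_add C t Y \<cdot> FArr P (prod_arr C f g)
      = \<lblot>\<one> Y, \<one> Y\<rblot> \<cdot> (t (Cod C f) (Cod C g) \<cdot> FArr P (prod_arr C f g))"
    using assms Y by (simp add: im_add_def)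
  also have "\<dots> = (\<lblot>\<one> Y, \<one> Y\<rblot> \<cdot> coprod_arr C f g) \<cdot> t (Dom C f) (Dom C g)"
    using assms Y t_natural[of f g] by simp
  also have "\<dots> = \<lblot>f,g\<rblot> \<cdot> t (Dom C f) (Dom C g)"
    using assms Y by (simp add: copairing_coprod_arr)
  finally show ?thesis .
qed

lemma im_plus_simps [simp]:
  assumes "W \<in> Obj C" "a \<in> Arr C" "Dom C a = FObj P W"
    and "b \<in> Arr C" "Dom C b = FObj P W" "Cod C b = Cod C a"
  shows "a \<oplus>\<^bsub>W\<^esub> b \<in> Arr C" "Dom C (a \<oplus>\<^bsub>W\<^esub> b) = FObj P W" "Cod C (a \<oplus>\<^bsub>W\<^esub> b) = Cod C a"
  using assms by (auto simp: im_plus_def)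

text \<open>Real morphisms are additive because \<open>t\<close> is natural and \<open>v\<close> commutes with codiagonals.\<close>

lemma comp_im_plus:
  assumes "W \<in> Obj C" "a \<in> Arr C" "Dom C a = FObj P W"
    and "b \<in> Arr C" "Dom C b = FObj P W" "Cod C b = Cod C a"
    and "v \<in> Arr C" "Dom C v = Cod C a"
  shows "v \<cdot> (a \<oplus>\<^bsub>W\<^esub> b) = (v \<cdot> a) \<oplus>\<^bsub>W\<^esub> (v \<cdot> b)"
proof -
  have X: "Cod C a \<in> Obj C"
    using assms by auto
  have "v \<cdot> im_add C t (Cod C a) = (v \<cdot> \<lblot>\<one> (Cod C a), \<one> (Cod C a)\<rblot>) \<cdot> t (Cod C a) (Cod C a)"
    using assms X by (simp add: im_add_def del: comp_copairing)
  also have "\<dots> = \<lblot>v,v\<rblot> \<cdot> t (Cod C a) (Cod C a)"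
    using assms X by simp
  also have "\<dots> = im_add C t (Cod C v) \<cdot> FArr P (prod_arr C v v)"
    using assms X by (simp add: im_add_FArr_prod_arr)
  finally have *: "v \<cdot> im_add C t (Cod C a) = im_add C t (Cod C v) \<cdot> FArr P (prod_arr C v v)" .
  have "v \<cdot> (a \<oplus>\<^bsub>W\<^esub> b) = im_comp C P W (v \<cdot> im_add C t (Cod C a)) \<langle>a,b\<rangle>"
    using assms X by (simp add: im_plus_def comp_im_comp)
  also have "\<dots> = im_comp C P W (im_add C t (Cod C v)) (prod_arr C v v \<cdot> \<langle>a,b\<rangle>)"
    unfolding * using assms X by (intro im_comp_FArr) auto
  also have "\<dots> = (v \<cdot> a) \<oplus>\<^bsub>W\<^esub> (v \<cdot> b)"
    using assms X by (simp add: im_plus_def)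
  finally show ?thesis .
qed

text \<open>Sums are computed pointwise, so an identity for the universal element \<open>\<epsilon>\<close> of an object
  specializes to all its imaginary elements.\<close>

lemma im_plus_im_comp:
  assumes "V \<in> Obj C" "c \<in> Arr C" "Dom C c = FObj P V" "Cod C c = W"
    and "a \<in> Arr C" "Dom C a = FObj P W" "b \<in> Arr C" "Dom C b = FObj P W" "Cod C b = Cod C a"
  shows "im_comp C P V (a \<oplus>\<^bsub>W\<^esub> b) c = im_comp C P V a c \<oplus>\<^bsub>V\<^esub> im_comp C P V b c"
  using assms by (auto simp: im_plus_def im_comp_assoc pairing_im_comp)

text \<open>Adding zero is \<open>\<mu> \<circ> (1 \<times> 0)\<close>, and naturality of \<open>t\<close> moves \<open>1 \<times> 0\<close> through \<open>t\<close>, where the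
  codiagonal becomes a component of the comparison \<open>r\<close>; then \<open>r t = \<epsilon>\<close> applies.\<close>

lemma im_plus_zero:
  assumes "W \<in> Obj C" "a \<in> Arr C" "Dom C a = FObj P W" "Cod C a = X"
  shows "a \<oplus>\<^bsub>W\<^esub> \<zero> (FObj P W) X = a"
proof -
  have X: "X \<in> Obj C"
    using assms by auto
  have "im_add C t X \<cdot> FArr P (prod_arr C (\<one> X) (\<zero> X X)) = \<lblot>\<one> X, \<zero> X X\<rblot> \<cdot> t X X"
    using X im_add_FArr_prod_arr[of "\<one> X" "\<zero> X X" X] by simp
  also have "\<dots> = (Pr1 C X X \<cdot> comparison C X X) \<cdot> t X X"
    using X by (simp add: comparison_def)
  also have "\<dots> = Pr1 C X X \<cdot> (comparison C X X \<cdot> t X X)"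
    using X by (intro assoc) (auto simp: comparison_def)
  also have "\<dots> = Pr1 C X X \<cdot> Counit P (Prod C X X)"
    using X by (simp add: comparison_t)
  finally have *: "im_add C t X \<cdot> FArr P (prod_arr C (\<one> X) (\<zero> X X))
      = Pr1 C X X \<cdot> Counit P (Prod C X X)" .
  have "a \<oplus>\<^bsub>W\<^esub> \<zero> (FObj P W) X
      = im_comp C P W (im_add C t X) (prod_arr C (\<one> X) (\<zero> X X) \<cdot> \<langle>a,a\<rangle>)"
    using assms X by (simp add: im_plus_def)
  also have "\<dots> = im_comp C P W (Pr1 C X X \<cdot> Counit P (Prod C X X)) \<langle>a,a\<rangle>"
    unfolding *[symmetric] using assms X by (intro im_comp_FArr[symmetric]) auto
  also have "\<dots> = a"
    using assms X im_comp_real[of W "\<langle>a,a\<rangle>" "Pr1 C X X"] by simp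
  finally show ?thesis .
qed

lemma zero_im_plus:
  assumes "W \<in> Obj C" "a \<in> Arr C" "Dom C a = FObj P W" "Cod C a = X"
  shows "\<zero> (FObj P W) X \<oplus>\<^bsub>W\<^esub> a = a"
proof -
  have X: "X \<in> Obj C"
    using assms by auto
  have "im_add C t X \<cdot> FArr P (prod_arr C (\<zero> X X) (\<one> X)) = \<lblot>\<zero> X X, \<one> X\<rblot> \<cdot> t X X"
    using X im_add_FArr_prod_arr[of "\<zero> X X" "\<one> X" X] by simp
  also have "\<dots> = (Pr2 C X X \<cdot> comparison C X X) \<cdot> t X X"
    using X by (simp add: comparison_def)
  also have "\<dots> = Pr2 C X X \<cdot> (comparison C X X \<cdot> t X X)"
    using X by (intro assoc) (auto simp: comparison_def)
  also have "\<dots> = Pr2 C X X \<cdot> Counit P (Prod C X X)"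
    using X by (simp add: comparison_t)
  finally have *: "im_add C t X \<cdot> FArr P (prod_arr C (\<zero> X X) (\<one> X))
      = Pr2 C X X \<cdot> Counit P (Prod C X X)" .
  have "\<zero> (FObj P W) X \<oplus>\<^bsub>W\<^esub> a
      = im_comp C P W (im_add C t X) (prod_arr C (\<zero> X X) (\<one> X) \<cdot> \<langle>a,a\<rangle>)"
    using assms X by (simp add: im_plus_def)
  also have "\<dots> = im_comp C P W (Pr2 C X X \<cdot> Counit P (Prod C X X)) \<langle>a,a\<rangle>"
    unfolding *[symmetric] using assms X by (intro im_comp_FArr[symmetric]) auto
  also have "\<dots> = a"
    using assms X im_comp_real[of W "\<langle>a,a\<rangle>" "Pr2 C X X"] by simp
  finally show ?thesis .
qed

text \<open>The associativity axiom is an equation between imaginary morphisms out of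
  \<open>(X \<times> X) \<times> X\<close>; evaluating it at \<open>\<langle>\<langle>a,b\<rangle>,c\<rangle>\<close> gives associativity of the addition.\<close>

lemma im_plus_assoc:
  assumes "W \<in> Obj C" "a \<in> Arr C" "Dom C a = FObj P W" "Cod C b = Cod C a"
    and "b \<in> Arr C" "Dom C b = FObj P W" "c \<in> Arr C" "Dom C c = FObj P W" "Cod C c = Cod C a"
  shows "(a \<oplus>\<^bsub>W\<^esub> b) \<oplus>\<^bsub>W\<^esub> c = a \<oplus>\<^bsub>W\<^esub> (b \<oplus>\<^bsub>W\<^esub> c)"
proof -
  define X where "X = Cod C a"
  define L where "L = Prod C (Prod C X X) X"
  define R where "R = Prod C X (Prod C X X)"
  have [simp]: "X \<in> Obj C" "Cod C a = X" "Cod C b = X" "Cod C c = X"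
    using assms by (auto simp: X_def)
  have [simp]: "L \<in> Obj C" "R \<in> Obj C"
    by (auto simp: L_def R_def)
  let ?\<mu> = "im_add C t X" and ?e = "\<langle>\<langle>a,b\<rangle>,c\<rangle>" and ?e' = "\<langle>a,\<langle>b,c\<rangle>\<rangle>"
  let ?l = "?\<mu> \<cdot> FArr P (Pr1 C (Prod C X X) X) \<oplus>\<^bsub>L\<^esub> Counit P X \<cdot> FArr P (Pr2 C (Prod C X X) X)"
  let ?r = "Counit P X \<cdot> FArr P (Pr1 C X (Prod C X X)) \<oplus>\<^bsub>R\<^esub> ?\<mu> \<cdot> FArr P (Pr2 C X (Prod C X X))"
  have "im_comp C P L ?\<mu> (im_prod C P (Prod C X X) X ?\<mu> (im_of_real C P (\<one> X)))
      = im_comp C P R ?\<mu> (im_prod C P X (Prod C X X) (im_of_real C P (\<one> X)) ?\<mu>)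
        \<cdot> FArr P (prod_assoc C X X X)"
    using associative unfolding im_add_associative_def L_def R_def by simp
  then have *: "?l = ?r \<cdot> FArr P (prod_assoc C X X X)"
    by (simp add: im_prod_def im_plus_def im_of_real_def)
  have e: "?e \<in> Arr C" "Dom C ?e = FObj P W" "Cod C ?e = L"
    and e': "?e' \<in> Arr C" "Dom C ?e' = FObj P W" "Cod C ?e' = R"
    using assms by (auto simp: L_def R_def)
  have assoc_arr: "prod_assoc C X X X \<in> Arr C" "Dom C (prod_assoc C X X X) = L"
    "Cod C (prod_assoc C X X X) = R"
    by (auto simp: prod_assoc_def L_def R_def)
  have assoc_e: "prod_assoc C X X X \<cdot> ?e = ?e'"
    using assms by (simp add: prod_assoc_def)
  have "im_comp C P W ?l ?e = (a \<oplus>\<^bsub>W\<^esub> b) \<oplus>\<^bsub>W\<^esub> c"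
  proof -
    have "im_comp C P W ?l ?e = im_comp C P W (?\<mu> \<cdot> FArr P (Pr1 C (Prod C X X) X)) ?e
        \<oplus>\<^bsub>W\<^esub> im_comp C P W (Counit P X \<cdot> FArr P (Pr2 C (Prod C X X) X)) ?e"
      using assms e by (intro im_plus_im_comp) (auto simp: L_def)
    also have "\<dots> = im_comp C P W ?\<mu> \<langle>a,b\<rangle> \<oplus>\<^bsub>W\<^esub> c"
      using assms by (simp add: im_comp_FArr im_comp_Counit)
    finally show ?thesis
      by (simp add: im_plus_def[of a])
  qed
  moreover have "im_comp C P W (?r \<cdot> FArr P (prod_assoc C X X X)) ?e = a \<oplus>\<^bsub>W\<^esub> (b \<oplus>\<^bsub>W\<^esub> c)"
  proof -
    have "?r \<in> Arr C" "Dom C ?r = FObj P R"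
      by (auto simp: R_def)
    then have "im_comp C P W (?r \<cdot> FArr P (prod_assoc C X X X)) ?e = im_comp C P W ?r ?e'"
      using assms e assoc_arr by (subst im_comp_FArr) (simp_all add: assoc_e)
    also have "\<dots> = im_comp C P W (Counit P X \<cdot> FArr P (Pr1 C X (Prod C X X))) ?e'
        \<oplus>\<^bsub>W\<^esub> im_comp C P W (?\<mu> \<cdot> FArr P (Pr2 C X (Prod C X X))) ?e'"
      using assms e' by (intro im_plus_im_comp) (auto simp: R_def)
    also have "\<dots> = a \<oplus>\<^bsub>W\<^esub> im_comp C P W ?\<mu> \<langle>b,c\<rangle>"
      using assms by (simp add: im_comp_FArr im_comp_Counit)
    finally show ?thesis
      by (simp add: im_plus_def[of b])
  qed
  ultimately show ?thesis
    using * by simp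
qed

end

section \<open>Intrinsic Schreier split epimorphisms as unique decompositions\<close>

locale imaginary_addition_kernels = imaginary_addition C P t
  for C :: "('o, 'm, 'x) bicat_scheme" (structure)
    and P :: "('o, 'm, 'y) comonad_data_scheme" and t +
  assumes finitely_complete: "finitely_complete C"
begin

text \<open>The kernel enters only through the elements that \<open>f\<close> annihilates. No kernel arrow and no
  retraction \<open>q\<close> has to be carried along, and existence and uniqueness of the kernel component
  become separate conditions on elements.\<close>

definition uniquely_decomposing :: "'m \<Rightarrow> 'm \<Rightarrow> bool" where
  "uniquely_decomposing f s \<longleftrightarrow> (\<forall>W \<in> Obj C.
    (\<forall>x \<in> im_hom W (Dom C f). \<exists>a \<in> im_hom W (Dom C f).
      f \<cdot> a = \<zero> (FObj P W) (Cod C f) \<and> x = a \<oplus>\<^bsub>W\<^esub> s \<cdot> (f \<cdot> x)) \<and>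
    (\<forall>a \<in> im_hom W (Dom C f). \<forall>a' \<in> im_hom W (Dom C f). \<forall>b \<in> im_hom W (Cod C f).
      f \<cdot> a = \<zero> (FObj P W) (Cod C f) \<longrightarrow> f \<cdot> a' = \<zero> (FObj P W) (Cod C f) \<longrightarrow>
      a \<oplus>\<^bsub>W\<^esub> s \<cdot> b = a' \<oplus>\<^bsub>W\<^esub> s \<cdot> b \<longrightarrow> a = a'))"

lemma uniquely_decomposingI:
  assumes "Dom C f = X" "Cod C f = Y"
    and "\<And>W x. W \<in> Obj C \<Longrightarrow> x \<in> Arr C \<Longrightarrow> Dom C x = FObj P W \<Longrightarrow> Cod C x = X \<Longrightarrow>
      \<exists>a \<in> im_hom W X. f \<cdot> a = \<zero> (FObj P W) Y \<and> x = a \<oplus>\<^bsub>W\<^esub> s \<cdot> (f \<cdot> x)"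
    and "\<And>W a a' b. W \<in> Obj C \<Longrightarrow>
      a \<in> Arr C \<Longrightarrow> Dom C a = FObj P W \<Longrightarrow> Cod C a = X \<Longrightarrow>
      a' \<in> Arr C \<Longrightarrow> Dom C a' = FObj P W \<Longrightarrow> Cod C a' = X \<Longrightarrow>
      b \<in> Arr C \<Longrightarrow> Dom C b = FObj P W \<Longrightarrow> Cod C b = Y \<Longrightarrow>
      f \<cdot> a = \<zero> (FObj P W) Y \<Longrightarrow> f \<cdot> a' = \<zero> (FObj P W) Y \<Longrightarrow>
      a \<oplus>\<^bsub>W\<^esub> s \<cdot> b = a' \<oplus>\<^bsub>W\<^esub> s \<cdot> b \<Longrightarrow> a = a'"
  shows "uniquely_decomposing f s"
  unfolding uniquely_decomposing_def assms(1,2)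
proof (intro ballI conjI impI)
  fix W x
  assume "W \<in> Obj C" "x \<in> im_hom W X"
  then show "\<exists>a \<in> im_hom W X. f \<cdot> a = \<zero> (FObj P W) Y \<and> x = a \<oplus>\<^bsub>W\<^esub> s \<cdot> (f \<cdot> x)"
    by (intro assms(3)) (auto simp: hom_iff)
next
  fix W a a' b
  assume "W \<in> Obj C" "a \<in> im_hom W X" "a' \<in> im_hom W X" "b \<in> im_hom W Y"
    and "f \<cdot> a = \<zero> (FObj P W) Y" "f \<cdot> a' = \<zero> (FObj P W) Y"
    and "a \<oplus>\<^bsub>W\<^esub> s \<cdot> b = a' \<oplus>\<^bsub>W\<^esub> s \<cdot> b"
  then show "a = a'"
    using assms(4)[of W a a' b] by (simp add: hom_iff)
qed

lemma uniquely_decomposingE: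
  assumes "uniquely_decomposing f s" "W \<in> Obj C" "x \<in> Arr C" "Dom C x = FObj P W"
    and "Cod C x = Dom C f"
  obtains a where "a \<in> Arr C" "Dom C a = FObj P W" "Cod C a = Dom C f"
    "f \<cdot> a = \<zero> (FObj P W) (Cod C f)" "x = a \<oplus>\<^bsub>W\<^esub> s \<cdot> (f \<cdot> x)"
proof -
  have "x \<in> im_hom W (Dom C f)"
    using assms by (simp add: hom_iff)
  then obtain a where "a \<in> im_hom W (Dom C f)" "f \<cdot> a = \<zero> (FObj P W) (Cod C f)"
    "x = a \<oplus>\<^bsub>W\<^esub> s \<cdot> (f \<cdot> x)"
    using assms(1,2) unfolding uniquely_decomposing_def by blast
  then show ?thesis
    using that unfolding hom_iff by blast
qed

lemma uniquely_decomposing_cancel: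
  assumes "uniquely_decomposing f s" "W \<in> Obj C" "a \<oplus>\<^bsub>W\<^esub> s \<cdot> b = a' \<oplus>\<^bsub>W\<^esub> s \<cdot> b"
    and "a \<in> Arr C" "Dom C a = FObj P W" "Cod C a = Dom C f" "f \<cdot> a = \<zero> (FObj P W) (Cod C f)"
    and "a' \<in> Arr C" "Dom C a' = FObj P W" "Cod C a' = Dom C f" "f \<cdot> a' = \<zero> (FObj P W) (Cod C f)"
    and "b \<in> Arr C" "Dom C b = FObj P W" "Cod C b = Cod C f"
  shows "a = a'"
proof -
  have "a \<in> im_hom W (Dom C f)" "a' \<in> im_hom W (Dom C f)" "b \<in> im_hom W (Cod C f)"
    using assms by (auto simp: hom_iff)
  then show ?thesis
    using assms(1,2,3,7,11) unfolding uniquely_decomposing_def by blast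
qed

text \<open>The two Schreier equations are evaluated at elements: the first at \<open>x\<close> gives the
  decomposition with \<open>a = k (q \<circ> x)\<close>, the second at \<open>\<langle>a,b\<rangle>\<close> gives \<open>q \<circ> (k a + s b) = a\<close>, which
  recovers the kernel component from the sum.\<close>

lemma intrinsic_schreier_decomposing:
  assumes "(f, s) \<in> intrinsic_schreier C P t"
  shows "uniquely_decomposing f s"
proof -
  obtain k q where fs: "(f, s) \<in> points C" and k: "is_kernel C f k"
    and q: "q \<in> hom C (FObj P (Dom C f)) (Dom C k)"
    and dec: "im_comp C P (Dom C f) (im_add C t (Dom C f))
        \<langle>k \<cdot> q, im_of_real C P (s \<cdot> f)\<rangle> = im_of_real C P (\<one> (Dom C f))"
    and retr: "im_comp C P (Prod C (Dom C k) (Cod C f)) q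
        (im_add C t (Dom C f) \<cdot> FArr P (prod_arr C k s))
        = im_of_real C P (Pr1 C (Dom C k) (Cod C f))"
    using assms unfolding intrinsic_schreier_def by blast
  define X Y K where "X = Dom C f" and "Y = Cod C f" and "K = Dom C k"
  have [simp]: "f \<in> Arr C" "Dom C f = X" "Cod C f = Y" "s \<in> Arr C" "Dom C s = Y" "Cod C s = X"
    "k \<in> Arr C" "Dom C k = K" "Cod C k = X" "q \<in> Arr C" "Dom C q = FObj P X" "Cod C q = K"
    and fk: "f \<cdot> k = \<zero> K Y"
    using fs k q by (auto simp: X_def Y_def K_def points_def is_kernel_def hom_iff)
  have [simp]: "X \<in> Obj C" "Y \<in> Obj C" "K \<in> Obj C"
    using Dom_Obj[of f] Cod_Obj[of f] Dom_Obj[of k] by simp_all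
  have dec': "k \<cdot> q \<oplus>\<^bsub>X\<^esub> s \<cdot> (f \<cdot> Counit P X) = Counit P X"
    using dec by (simp add: im_plus_def im_of_real_def)
  have retr': "im_comp C P (Prod C K Y) q (im_add C t X \<cdot> FArr P (prod_arr C k s))
      = Pr1 C K Y \<cdot> Counit P (Prod C K Y)"
    using retr by (simp add: im_of_real_def)
  have retract: "im_comp C P W q (k \<cdot> a \<oplus>\<^bsub>W\<^esub> s \<cdot> b) = a"
    if [simp]: "W \<in> Obj C" "a \<in> Arr C" "Dom C a = FObj P W" "Cod C a = K"
      "b \<in> Arr C" "Dom C b = FObj P W" "Cod C b = Y" for W a b
  proof -
    have "im_comp C P W (im_add C t X \<cdot> FArr P (prod_arr C k s)) \<langle>a,b\<rangle> = k \<cdot> a \<oplus>\<^bsub>W\<^esub> s \<cdot> b"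
      by (simp add: im_comp_FArr im_plus_def)
    then have "im_comp C P W q (k \<cdot> a \<oplus>\<^bsub>W\<^esub> s \<cdot> b)
        = im_comp C P W (im_comp C P (Prod C K Y) q
            (im_add C t X \<cdot> FArr P (prod_arr C k s))) \<langle>a,b\<rangle>"
      by (simp add: im_comp_assoc)
    also have "\<dots> = a"
      unfolding retr' using im_comp_real[of W "\<langle>a,b\<rangle>" "Pr1 C K Y"] by simp
    finally show ?thesis .
  qed
  have "\<exists>a \<in> im_hom W X. f \<cdot> a = \<zero> (FObj P W) Y \<and> x = a \<oplus>\<^bsub>W\<^esub> s \<cdot> (f \<cdot> x)"
    if [simp]: "W \<in> Obj C" "x \<in> Arr C" "Dom C x = FObj P W" "Cod C x = X" for W x
  proof -
    have "x = im_comp C P W (k \<cdot> q \<oplus>\<^bsub>X\<^esub> s \<cdot> (f \<cdot> Counit P X)) x"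
      by (simp add: dec' im_comp_Counit)
    also have "\<dots> = im_comp C P W (k \<cdot> q) x \<oplus>\<^bsub>W\<^esub> im_comp C P W (s \<cdot> (f \<cdot> Counit P X)) x"
      by (rule im_plus_im_comp) simp_all
    also have "\<dots> = k \<cdot> im_comp C P W q x \<oplus>\<^bsub>W\<^esub> s \<cdot> (f \<cdot> x)"
      by (simp add: comp_im_comp im_comp_Counit)
    finally have "x = k \<cdot> im_comp C P W q x \<oplus>\<^bsub>W\<^esub> s \<cdot> (f \<cdot> x)" .
    moreover have "f \<cdot> (k \<cdot> im_comp C P W q x) = \<zero> (FObj P W) Y"
      using fk by (simp flip: assoc)
    ultimately show ?thesis
      by (intro bexI[of _ "k \<cdot> im_comp C P W q x"]) (simp_all add: hom_iff)
  qed
  moreover have "a = a'"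
    if [simp]: "W \<in> Obj C" "a \<in> Arr C" "Dom C a = FObj P W" "Cod C a = X"
      "a' \<in> Arr C" "Dom C a' = FObj P W" "Cod C a' = X"
      "b \<in> Arr C" "Dom C b = FObj P W" "Cod C b = Y"
      and zero: "f \<cdot> a = \<zero> (FObj P W) Y" "f \<cdot> a' = \<zero> (FObj P W) Y"
      and eq: "a \<oplus>\<^bsub>W\<^esub> s \<cdot> b = a' \<oplus>\<^bsub>W\<^esub> s \<cdot> b" for W a a' b
  proof -
    obtain c where [simp]: "c \<in> Arr C" "Dom C c = FObj P W" "Cod C c = K" and c: "k \<cdot> c = a"
      using kernel_factors[OF k, of a] zero by auto
    obtain c' where [simp]: "c' \<in> Arr C" "Dom C c' = FObj P W" "Cod C c' = K" and c': "k \<cdot> c' = a'"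
      using kernel_factors[OF k, of a'] zero by auto
    have "c = c'"
      using retract[of W c b] retract[of W c' b] eq by (simp add: c c')
    then show ?thesis
      using c c' by simp
  qed
  ultimately show ?thesis
    by (intro uniquely_decomposingI[of f X Y]) simp_all
qed

lemma im_comp_Counit_right:
  assumes "W \<in> Obj C" "a \<in> Arr C" "Dom C a = FObj P W"
  shows "im_comp C P W a (Counit P W) = a"
  using assms by (simp add: im_comp_def FArr_Counit_Comult)

text \<open>The retraction \<open>q\<close> is obtained by decomposing the universal element \<open>\<epsilon>\<close> of \<open>X\<close>. The second
  Schreier equation compares two decompositions of one element of \<open>X\<close> over \<open>K \<times> Y\<close>: the one given
  by \<open>q\<close> and the one by which this element is defined.\<close>

lemma decomposing_intrinsic_schreier:
  assumes fs: "(f, s) \<in> points C" and dec: "uniquely_decomposing f s"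
  shows "(f, s) \<in> intrinsic_schreier C P t"
proof -
  define X Y where "X = Dom C f" and "Y = Cod C f"
  have [simp]: "f \<in> Arr C" "Dom C f = X" "Cod C f = Y" "s \<in> Arr C" "Dom C s = Y" "Cod C s = X"
    and fs1: "f \<cdot> s = \<one> Y"
    using fs by (auto simp: X_def Y_def points_def hom_iff)
  have [simp]: "X \<in> Obj C" "Y \<in> Obj C"
    using Dom_Obj[of f] Cod_Obj[of f] by simp_all
  obtain k where k: "is_kernel C f k"
    using kernel_exists finitely_complete \<open>f \<in> Arr C\<close> by blast
  define K where "K = Dom C k"
  have [simp]: "k \<in> Arr C" "Dom C k = K" "Cod C k = X" and fk: "f \<cdot> k = \<zero> K Y"
    using k by (auto simp: K_def is_kernel_def)
  have [simp]: "K \<in> Obj C"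
    using Dom_Obj[of k] by simp
  have fkx: "f \<cdot> (k \<cdot> x) = \<zero> (Dom C x) Y" if "x \<in> Arr C" "Cod C x = K" for x
    using that fk by (simp flip: assoc)
  have fsx: "f \<cdot> (s \<cdot> x) = x" if "x \<in> Arr C" "Cod C x = Y" for x
    using that fs1 by (simp flip: assoc)
  obtain a where [simp]: "a \<in> Arr C" "Dom C a = FObj P X" "Cod C a = X"
    and a0: "f \<cdot> a = \<zero> (FObj P X) Y" and a: "Counit P X = a \<oplus>\<^bsub>X\<^esub> s \<cdot> (f \<cdot> Counit P X)"
    by (rule uniquely_decomposingE[OF dec, of X "Counit P X"]) simp_all
  obtain q where [simp]: "q \<in> Arr C" "Dom C q = FObj P X" "Cod C q = K" and q: "k \<cdot> q = a"
    using kernel_factors[OF k, of a] a0 by auto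
  define V where "V = Prod C K Y"
  define m where "m = im_add C t X \<cdot> FArr P (prod_arr C k s)"
  have [simp]: "V \<in> Obj C" "Dom C m = FObj P V" "Cod C m = X" "m \<in> Arr C"
    by (simp_all add: V_def m_def)
  let ?k = "k \<cdot> (Pr1 C K Y \<cdot> Counit P V)" and ?b = "Pr2 C K Y \<cdot> Counit P V"
  \<comment> \<open>\<open>m\<close> is the universal sum of an element of the kernel and an element of the image of \<open>s\<close>.\<close>
  have m: "m = ?k \<oplus>\<^bsub>V\<^esub> s \<cdot> ?b"
  proof -
    have "m = im_comp C P V (im_add C t X \<cdot> FArr P (prod_arr C k s)) (Counit P V)"
      using im_comp_Counit_right[of V m] by (simp flip: m_def)
    also have "\<dots> = im_comp C P V (im_add C t X) (prod_arr C k s \<cdot> Counit P V)"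
      by (rule im_comp_FArr) (simp_all add: V_def)
    also have "prod_arr C k s \<cdot> Counit P V = \<langle>?k, s \<cdot> ?b\<rangle>"
      by (simp add: prod_arr_def V_def)
    finally show ?thesis
      by (simp add: im_plus_def V_def)
  qed
  have fm: "f \<cdot> m = ?b"
    unfolding m by (simp add: comp_im_plus fkx fsx zero_im_plus V_def)
  have "m = im_comp C P V (a \<oplus>\<^bsub>X\<^esub> s \<cdot> (f \<cdot> Counit P X)) m"
    by (simp add: im_comp_Counit flip: a)
  also have "\<dots> = im_comp C P V a m \<oplus>\<^bsub>V\<^esub> im_comp C P V (s \<cdot> (f \<cdot> Counit P X)) m"
    by (rule im_plus_im_comp) simp_all
  also have "\<dots> = k \<cdot> im_comp C P V q m \<oplus>\<^bsub>V\<^esub> s \<cdot> ?b"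
    by (simp add: comp_im_comp im_comp_Counit fm flip: q)
  finally have eq: "k \<cdot> im_comp C P V q m \<oplus>\<^bsub>V\<^esub> s \<cdot> ?b = ?k \<oplus>\<^bsub>V\<^esub> s \<cdot> ?b"
    using m by simp
  have "k \<cdot> im_comp C P V q m = ?k"
    by (rule uniquely_decomposing_cancel[OF dec _ eq]) (simp_all add: fkx V_def)
  then have retr: "im_comp C P V q m = Pr1 C K Y \<cdot> Counit P V"
    by (rule kernel_monic[OF k, rotated -1]) (simp_all add: V_def)
  have "im_comp C P X (im_add C t X) \<langle>k \<cdot> q, im_of_real C P (s \<cdot> f)\<rangle> = im_of_real C P (\<one> X)"
    using a by (simp add: im_of_real_def im_plus_def q)
  moreover have "im_comp C P (Prod C K Y) q (im_add C t X \<cdot> FArr P (prod_arr C k s))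
      = im_of_real C P (Pr1 C K Y)"
    using retr by (simp add: im_of_real_def m_def V_def)
  ultimately show ?thesis
    unfolding intrinsic_schreier_def using fs k
    by (simp, intro exI[of _ k], simp, intro exI[of _ q], simp add: hom_iff)
qed

text \<open>An element of the pullback is a pair of elements of \<open>Dom f\<close> and \<open>Dom g\<close> with equal images.
  The element \<open>(x,y)\<close> decomposes as \<open>(a,0) + (s f x, y)\<close> if \<open>x = a + s f x\<close>, and cancellation can
  be tested in each component.\<close>

lemma uniquely_decomposing_pullback:
  assumes dec: "uniquely_decomposing f s" and fs: "(f, s) \<in> points C"
    and pb: "is_pullback C f g p f'"
    and s': "s' \<in> hom C (Cod C f') (Dom C f')" "p \<cdot> s' = s \<cdot> g" "f' \<cdot> s' = \<one> (Cod C f')"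
  shows "uniquely_decomposing f' s'"
proof -
  define X Y X' Y' where "X = Dom C f" and "Y = Cod C f" and "X' = Dom C f'" and "Y' = Cod C f'"
  have [simp]: "f \<in> Arr C" "Dom C f = X" "Cod C f = Y" "s \<in> Arr C" "Dom C s = Y" "Cod C s = X"
    "f' \<in> Arr C" "Dom C f' = X'" "Cod C f' = Y'" "s' \<in> Arr C" "Dom C s' = Y'" "Cod C s' = X'"
    "p \<in> Arr C" "Dom C p = X'" "Cod C p = X" "g \<in> Arr C" "Dom C g = Y'" "Cod C g = Y"
    and sq: "f \<cdot> p = g \<cdot> f'"
    using fs pb s' by (auto simp: X_def Y_def X'_def Y'_def points_def is_pullback_def hom_iff)
  have [simp]: "X \<in> Obj C" "Y \<in> Obj C" "X' \<in> Obj C" "Y' \<in> Obj C"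
    using Dom_Obj[of f] Cod_Obj[of f] Dom_Obj[of f'] Cod_Obj[of f'] by simp_all
  have universal: "\<exists>!h. h \<in> hom C W X' \<and> p \<cdot> h = a \<and> f' \<cdot> h = b"
    if "a \<in> hom C W X" "b \<in> hom C W Y'" "f \<cdot> a = g \<cdot> b" for W a b
    using pb that unfolding is_pullback_def by simp
  have fpx: "f \<cdot> (p \<cdot> x) = g \<cdot> (f' \<cdot> x)" if "x \<in> Arr C" "Cod C x = X'" for x
    using that by (intro comp_cong[OF sq]) simp_all
  have psx: "p \<cdot> (s' \<cdot> x) = s \<cdot> (g \<cdot> x)" if "x \<in> Arr C" "Cod C x = Y'" for x
    using that by (intro comp_cong[OF s'(2)]) simp_all
  have fsx: "f' \<cdot> (s' \<cdot> x) = x" if "x \<in> Arr C" "Cod C x = Y'" for x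
    using that by (intro comp_cong_Ide[OF s'(3)]) simp_all
  have ext: "x = y"
    if "x \<in> Arr C" "Cod C x = X'" "y \<in> Arr C" "Cod C y = X'" "Dom C y = Dom C x"
      "p \<cdot> x = p \<cdot> y" "f' \<cdot> x = f' \<cdot> y" for x y
  proof -
    have "p \<cdot> x \<in> hom C (Dom C x) X" "f' \<cdot> x \<in> hom C (Dom C x) Y'" "f \<cdot> (p \<cdot> x) = g \<cdot> (f' \<cdot> x)"
      using that(1,2) fpx by (simp_all add: hom_iff)
    from universal[OF this] show ?thesis
      using that by (auto simp: hom_iff)
  qed
  have "\<exists>h \<in> im_hom W X'. f' \<cdot> h = \<zero> (FObj P W) Y' \<and> x = h \<oplus>\<^bsub>W\<^esub> s' \<cdot> (f' \<cdot> x)"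
    if [simp]: "W \<in> Obj C" "x \<in> Arr C" "Dom C x = FObj P W" "Cod C x = X'" for W x
  proof -
    obtain a where [simp]: "a \<in> Arr C" "Dom C a = FObj P W" "Cod C a = X"
      "f \<cdot> a = \<zero> (FObj P W) Y" and a: "p \<cdot> x = a \<oplus>\<^bsub>W\<^esub> s \<cdot> (f \<cdot> (p \<cdot> x))"
      by (rule uniquely_decomposingE[OF dec, of W "p \<cdot> x"]) simp_all
    obtain h where [simp]: "h \<in> Arr C" "Dom C h = FObj P W" "Cod C h = X'"
      and h: "p \<cdot> h = a" "f' \<cdot> h = \<zero> (FObj P W) Y'"
      using universal[of a "FObj P W" "\<zero> (FObj P W) Y'"] by (auto simp: hom_iff)
    have "x = h \<oplus>\<^bsub>W\<^esub> s' \<cdot> (f' \<cdot> x)"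
    proof (rule ext)
      show "p \<cdot> x = p \<cdot> (h \<oplus>\<^bsub>W\<^esub> s' \<cdot> (f' \<cdot> x))"
        by (subst a) (simp add: comp_im_plus h psx fpx)
      show "f' \<cdot> x = f' \<cdot> (h \<oplus>\<^bsub>W\<^esub> s' \<cdot> (f' \<cdot> x))"
        by (simp add: comp_im_plus h fsx zero_im_plus)
    qed simp_all
    then show ?thesis
      using h by (intro bexI[of _ h]) (simp_all add: hom_iff)
  qed
  moreover have "a = a'"
    if [simp]: "W \<in> Obj C" "a \<in> Arr C" "Dom C a = FObj P W" "Cod C a = X'"
      "a' \<in> Arr C" "Dom C a' = FObj P W" "Cod C a' = X'"
      "b \<in> Arr C" "Dom C b = FObj P W" "Cod C b = Y'"
      "f' \<cdot> a = \<zero> (FObj P W) Y'" "f' \<cdot> a' = \<zero> (FObj P W) Y'"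
      and eq: "a \<oplus>\<^bsub>W\<^esub> s' \<cdot> b = a' \<oplus>\<^bsub>W\<^esub> s' \<cdot> b" for W a a' b
  proof (rule ext)
    have "p \<cdot> (a \<oplus>\<^bsub>W\<^esub> s' \<cdot> b) = p \<cdot> (a' \<oplus>\<^bsub>W\<^esub> s' \<cdot> b)"
      by (simp add: eq)
    then have "p \<cdot> a \<oplus>\<^bsub>W\<^esub> s \<cdot> (g \<cdot> b) = p \<cdot> a' \<oplus>\<^bsub>W\<^esub> s \<cdot> (g \<cdot> b)"
      by (simp add: comp_im_plus psx)
    then show "p \<cdot> a = p \<cdot> a'"
      by (rule uniquely_decomposing_cancel[OF dec, rotated]) (simp_all add: fpx)
  qed simp_all
  ultimately show ?thesis
    by (intro uniquely_decomposingI[of f' X' Y']) simp_all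
qed

section \<open>Equi-consistency\<close>

text \<open>Symmetry of the relation supplies the inverses: decomposing the mirror image of an element
  of the kernel of \<open>r1\<close> yields a left inverse in the same kernel.\<close>

lemma kernel_of_decomposing_relation_invertible:
  assumes rel: "equivalence_relation C X R r1 r2"
    and e: "e \<in> hom C X R" "r1 \<cdot> e = \<one> X" "r2 \<cdot> e = \<one> X"
    and dec: "uniquely_decomposing r1 e"
    and W: "W \<in> Obj C" and z: "z \<in> im_hom W R" "r1 \<cdot> z = \<zero> (FObj P W) X"
  obtains n where "n \<in> Arr C" "Dom C n = FObj P W" "Cod C n = R" "r1 \<cdot> n = \<zero> (FObj P W) X"
    "n \<oplus>\<^bsub>W\<^esub> z = \<zero> (FObj P W) R" "z \<oplus>\<^bsub>W\<^esub> n = \<zero> (FObj P W) R"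
proof -
  obtain i where "i \<in> hom C R R" and i: "r1 \<cdot> i = r2" "r2 \<cdot> i = r1"
    using rel unfolding equivalence_relation_def by blast
  then have [simp]: "r1 \<in> Arr C" "Dom C r1 = R" "Cod C r1 = X" "r2 \<in> Arr C" "Dom C r2 = R"
    "Cod C r2 = X" "e \<in> Arr C" "Dom C e = X" "Cod C e = R" "i \<in> Arr C" "Dom C i = R" "Cod C i = R"
    and mono: "monic C \<langle>r1,r2\<rangle>"
    using rel e(1) by (auto simp: equivalence_relation_def hom_iff)
  have [simp]: "X \<in> Obj C" "R \<in> Obj C" "W \<in> Obj C"
    using Dom_Obj[of e] Cod_Obj[of e] W by simp_all
  have ext: "x = y"
    if "x \<in> Arr C" "Cod C x = R" "y \<in> Arr C" "Cod C y = R" "Dom C y = Dom C x"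
      "r1 \<cdot> x = r1 \<cdot> y" "r2 \<cdot> x = r2 \<cdot> y" for x y
  proof -
    have "\<langle>r1,r2\<rangle> \<cdot> x = \<langle>r1,r2\<rangle> \<cdot> y"
      using that by simp
    then show ?thesis
      using mono that unfolding monic_def by (auto simp: hom_iff)
  qed
  have r1e: "r1 \<cdot> (e \<cdot> x) = x" if "x \<in> Arr C" "Cod C x = X" for x
    using that by (intro comp_cong_Ide[OF e(2)]) simp_all
  have r2e: "r2 \<cdot> (e \<cdot> x) = x" if "x \<in> Arr C" "Cod C x = X" for x
    using that by (intro comp_cong_Ide[OF e(3)]) simp_all
  have r1i: "r1 \<cdot> (i \<cdot> x) = r2 \<cdot> x" if "x \<in> Arr C" "Cod C x = R" for x
    using that i by (simp flip: assoc)
  have r2i: "r2 \<cdot> (i \<cdot> x) = r1 \<cdot> x" if "x \<in> Arr C" "Cod C x = R" for x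
    using that i by (simp flip: assoc)
  \<comment> \<open>Write \<open>z = (0,y)\<close>. Its mirror image decomposes as \<open>(y,0) = (0,n) + (y,y)\<close>, so \<open>n + y = 0\<close>.\<close>
  have left: "\<exists>n. n \<in> Arr C \<and> Dom C n = FObj P W \<and> Cod C n = R \<and> r1 \<cdot> n = \<zero> (FObj P W) X \<and>
      n \<oplus>\<^bsub>W\<^esub> z = \<zero> (FObj P W) R"
    if [simp]: "z \<in> Arr C" "Dom C z = FObj P W" "Cod C z = R" "r1 \<cdot> z = \<zero> (FObj P W) X" for z
  proof -
    obtain n where [simp]: "n \<in> Arr C" "Dom C n = FObj P W" "Cod C n = R"
      "r1 \<cdot> n = \<zero> (FObj P W) X" and n: "i \<cdot> z = n \<oplus>\<^bsub>W\<^esub> e \<cdot> (r1 \<cdot> (i \<cdot> z))"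
      by (rule uniquely_decomposingE[OF dec, of W "i \<cdot> z"]) simp_all
    have "n \<oplus>\<^bsub>W\<^esub> z = \<zero> (FObj P W) R"
    proof (rule ext)
      show "r1 \<cdot> (n \<oplus>\<^bsub>W\<^esub> z) = r1 \<cdot> \<zero> (FObj P W) R"
        by (simp add: comp_im_plus im_plus_zero)
      have "r2 \<cdot> (n \<oplus>\<^bsub>W\<^esub> z) = r2 \<cdot> (n \<oplus>\<^bsub>W\<^esub> e \<cdot> (r1 \<cdot> (i \<cdot> z)))"
        by (simp add: comp_im_plus r1i r2e)
      also have "\<dots> = r2 \<cdot> (i \<cdot> z)"
        by (simp flip: n)
      finally show "r2 \<cdot> (n \<oplus>\<^bsub>W\<^esub> z) = r2 \<cdot> \<zero> (FObj P W) R"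
        by (simp add: r2i)
    qed simp_all
    then show ?thesis
      by (intro exI[of _ n]) simp
  qed
  have [simp]: "z \<in> Arr C" "Dom C z = FObj P W" "Cod C z = R"
    using z by (simp_all add: hom_iff)
  obtain n where [simp]: "n \<in> Arr C" "Dom C n = FObj P W" "Cod C n = R"
    and n: "r1 \<cdot> n = \<zero> (FObj P W) X" "n \<oplus>\<^bsub>W\<^esub> z = \<zero> (FObj P W) R"
    using left[of z] z by auto
  obtain m where [simp]: "m \<in> Arr C" "Dom C m = FObj P W" "Cod C m = R"
    and m: "m \<oplus>\<^bsub>W\<^esub> n = \<zero> (FObj P W) R"
    using left[of n] n by auto
  \<comment> \<open>A left inverse that has a left inverse of its own is a two-sided inverse.\<close>
  have "m = m \<oplus>\<^bsub>W\<^esub> (n \<oplus>\<^bsub>W\<^esub> z)"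
    by (simp add: n im_plus_zero)
  also have "\<dots> = (m \<oplus>\<^bsub>W\<^esub> n) \<oplus>\<^bsub>W\<^esub> z"
    by (simp add: im_plus_assoc)
  also have "\<dots> = z"
    by (simp add: m zero_im_plus)
  finally have "z \<oplus>\<^bsub>W\<^esub> n = \<zero> (FObj P W) R"
    using m by simp
  then show ?thesis
    using that[of n] n by simp
qed

text \<open>The obvious candidate \<open>z + e c\<close> for the component of \<open>z + e (c + s f x)\<close> in the kernel of
  \<open>f'\<close> is off by the image of \<open>z\<close>, since \<open>f' (z + e c) = f' z\<close>. Invertibility in the kernel of
  \<open>r1\<close> corrects this by subtracting \<open>s' f' z\<close>. For cancellation, \<open>s' b = z + e d\<close> is removed in
  two steps: \<open>e d\<close> by the Schreier property of \<open>r1\<close>, then \<open>z\<close> by its inverse.\<close>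

lemma uniquely_decomposing_equi_consistent:
  assumes rel: "equivalence_relation C X R r1 r2"
    and e: "e \<in> hom C X R" "r1 \<cdot> e = \<one> X" "r2 \<cdot> e = \<one> X"
    and f: "f \<in> hom C X Y" "(f, s) \<in> points C"
    and f': "f' \<in> hom C R S" "(f', s') \<in> points C"
    and e': "e' \<in> hom C Y S" and s1: "s1 \<in> hom C S Y"
    and s1f': "s1 \<cdot> f' = f \<cdot> r1" and r1s': "r1 \<cdot> s' = s \<cdot> s1"
    and f'e: "f' \<cdot> e = e' \<cdot> f" and s'e': "s' \<cdot> e' = e \<cdot> s"
    and dec_f: "uniquely_decomposing f s" and dec_r1: "uniquely_decomposing r1 e"
  shows "uniquely_decomposing f' s'"
proof -
  have [simp]: "r1 \<in> Arr C" "Dom C r1 = R" "Cod C r1 = X"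
    "e \<in> Arr C" "Dom C e = X" "Cod C e = R"
    "f \<in> Arr C" "Dom C f = X" "Cod C f = Y" "s \<in> Arr C" "Dom C s = Y" "Cod C s = X"
    "f' \<in> Arr C" "Dom C f' = R" "Cod C f' = S" "s' \<in> Arr C" "Dom C s' = S" "Cod C s' = R"
    "e' \<in> Arr C" "Dom C e' = Y" "Cod C e' = S" "s1 \<in> Arr C" "Dom C s1 = S" "Cod C s1 = Y"
    and fs1: "f \<cdot> s = \<one> Y" and fs1': "f' \<cdot> s' = \<one> S"
    using rel e(1) f f' e' s1 by (auto simp: equivalence_relation_def points_def hom_iff)
  have obj [simp]: "X \<in> Obj C" "Y \<in> Obj C" "R \<in> Obj C" "S \<in> Obj C"
    using Dom_Obj[of f] Cod_Obj[of f] Dom_Obj[of f'] Cod_Obj[of f'] by simp_all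
  have r1e_x: "r1 \<cdot> (e \<cdot> x) = x" if "x \<in> Arr C" "Cod C x = X" for x
    using that by (intro comp_cong_Ide[OF e(2)]) simp_all
  have fs_x: "f \<cdot> (s \<cdot> x) = x" if "x \<in> Arr C" "Cod C x = Y" for x
    using that by (intro comp_cong_Ide[OF fs1]) simp_all
  have fs_x': "f' \<cdot> (s' \<cdot> x) = x" if "x \<in> Arr C" "Cod C x = S" for x
    using that by (intro comp_cong_Ide[OF fs1']) simp_all
  have s1f'_x: "s1 \<cdot> (f' \<cdot> x) = f \<cdot> (r1 \<cdot> x)" if "x \<in> Arr C" "Cod C x = R" for x
    using that by (intro comp_cong[OF s1f']) simp_all
  have r1s'_x: "r1 \<cdot> (s' \<cdot> x) = s \<cdot> (s1 \<cdot> x)" if "x \<in> Arr C" "Cod C x = S" for x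
    using that by (intro comp_cong[OF r1s']) simp_all
  have f'e_x: "f' \<cdot> (e \<cdot> x) = e' \<cdot> (f \<cdot> x)" if "x \<in> Arr C" "Cod C x = X" for x
    using that by (intro comp_cong[OF f'e]) simp_all
  have s'e'_x: "s' \<cdot> (e' \<cdot> x) = e \<cdot> (s \<cdot> x)" if "x \<in> Arr C" "Cod C x = Y" for x
    using that by (intro comp_cong[OF s'e']) simp_all
  have inverse: "\<exists>n. n \<in> Arr C \<and> Dom C n = FObj P W \<and> Cod C n = R \<and>
      n \<oplus>\<^bsub>W\<^esub> z = \<zero> (FObj P W) R \<and> z \<oplus>\<^bsub>W\<^esub> n = \<zero> (FObj P W) R"
    if "W \<in> Obj C" "z \<in> Arr C" "Dom C z = FObj P W" "Cod C z = R" "r1 \<cdot> z = \<zero> (FObj P W) X"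
    for W z
    by (rule kernel_of_decomposing_relation_invertible[OF rel e dec_r1, of W z])
      (use that in \<open>auto simp: hom_iff\<close>)
  have "\<exists>a \<in> im_hom W R. f' \<cdot> a = \<zero> (FObj P W) S \<and> x = a \<oplus>\<^bsub>W\<^esub> s' \<cdot> (f' \<cdot> x)"
    if [simp]: "W \<in> Obj C" "x \<in> Arr C" "Dom C x = FObj P W" "Cod C x = R" for W x
  proof -
    obtain z where [simp]: "z \<in> Arr C" "Dom C z = FObj P W" "Cod C z = R"
      "r1 \<cdot> z = \<zero> (FObj P W) X" and z: "x = z \<oplus>\<^bsub>W\<^esub> e \<cdot> (r1 \<cdot> x)"
      by (rule uniquely_decomposingE[OF dec_r1, of W x]) simp_all
    obtain c where [simp]: "c \<in> Arr C" "Dom C c = FObj P W" "Cod C c = X"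
      "f \<cdot> c = \<zero> (FObj P W) Y" and c: "r1 \<cdot> x = c \<oplus>\<^bsub>W\<^esub> s \<cdot> (f \<cdot> (r1 \<cdot> x))"
      by (rule uniquely_decomposingE[OF dec_f, of W "r1 \<cdot> x"]) simp_all
    define w where "w = s' \<cdot> (f' \<cdot> z)"
    define d where "d = e \<cdot> (s \<cdot> (f \<cdot> (r1 \<cdot> x)))"
    have [simp]: "w \<in> Arr C" "Dom C w = FObj P W" "Cod C w = R"
      "d \<in> Arr C" "Dom C d = FObj P W" "Cod C d = R"
      by (simp_all add: w_def d_def)
    have "r1 \<cdot> w = \<zero> (FObj P W) X"
      by (simp add: w_def r1s'_x s1f'_x)
    then obtain n where [simp]: "n \<in> Arr C" "Dom C n = FObj P W" "Cod C n = R"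
      and n: "n \<oplus>\<^bsub>W\<^esub> w = \<zero> (FObj P W) R" "w \<oplus>\<^bsub>W\<^esub> n = \<zero> (FObj P W) R"
      using inverse[of W w] by auto
    have x: "x = z \<oplus>\<^bsub>W\<^esub> (e \<cdot> c \<oplus>\<^bsub>W\<^esub> d)"
    proof -
      have "e \<cdot> (r1 \<cdot> x) = e \<cdot> c \<oplus>\<^bsub>W\<^esub> d"
        by (subst c) (simp add: comp_im_plus d_def)
      then show ?thesis
        using z by simp
    qed
    have s'f'd: "s' \<cdot> (f' \<cdot> d) = d"
      by (simp add: d_def f'e_x s'e'_x fs_x)
    have s'f'x: "s' \<cdot> (f' \<cdot> x) = w \<oplus>\<^bsub>W\<^esub> d"
      by (subst x) (simp add: comp_im_plus f'e_x s'f'd zero_im_plus flip: w_def)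
    have f'w: "f' \<cdot> w = f' \<cdot> z"
      by (simp add: w_def fs_x')
    define a where "a = z \<oplus>\<^bsub>W\<^esub> (e \<cdot> c \<oplus>\<^bsub>W\<^esub> n)"
    have [simp]: "a \<in> Arr C" "Dom C a = FObj P W" "Cod C a = R"
      by (simp_all add: a_def)
    have "f' \<cdot> a = f' \<cdot> w \<oplus>\<^bsub>W\<^esub> f' \<cdot> n"
      by (simp add: a_def comp_im_plus f'e_x f'w zero_im_plus)
    also have "\<dots> = f' \<cdot> (w \<oplus>\<^bsub>W\<^esub> n)"
      by (simp add: comp_im_plus)
    also have "\<dots> = \<zero> (FObj P W) S"
      by (simp add: n)
    finally have f'a: "f' \<cdot> a = \<zero> (FObj P W) S" .
    have "a \<oplus>\<^bsub>W\<^esub> s' \<cdot> (f' \<cdot> x) = z \<oplus>\<^bsub>W\<^esub> (e \<cdot> c \<oplus>\<^bsub>W\<^esub> (n \<oplus>\<^bsub>W\<^esub> (w \<oplus>\<^bsub>W\<^esub> d)))"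
      by (simp add: a_def s'f'x im_plus_assoc)
    also have "n \<oplus>\<^bsub>W\<^esub> (w \<oplus>\<^bsub>W\<^esub> d) = (n \<oplus>\<^bsub>W\<^esub> w) \<oplus>\<^bsub>W\<^esub> d"
      by (simp add: im_plus_assoc)
    also have "\<dots> = d"
      by (simp add: n zero_im_plus)
    finally have "x = a \<oplus>\<^bsub>W\<^esub> s' \<cdot> (f' \<cdot> x)"
      using x by simp
    then show ?thesis
      using f'a by (intro bexI[of _ a]) (simp_all add: hom_iff)
  qed
  moreover have "a = a'"
    if [simp]: "W \<in> Obj C" "a \<in> Arr C" "Dom C a = FObj P W" "Cod C a = R"
      "a' \<in> Arr C" "Dom C a' = FObj P W" "Cod C a' = R"
      "b \<in> Arr C" "Dom C b = FObj P W" "Cod C b = S"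
      "f' \<cdot> a = \<zero> (FObj P W) S" "f' \<cdot> a' = \<zero> (FObj P W) S"
      and eq: "a \<oplus>\<^bsub>W\<^esub> s' \<cdot> b = a' \<oplus>\<^bsub>W\<^esub> s' \<cdot> b" for W a a' b
  proof -
    \<comment> \<open>The first components agree, by cancellation for \<open>f\<close>.\<close>
    have "r1 \<cdot> (a \<oplus>\<^bsub>W\<^esub> s' \<cdot> b) = r1 \<cdot> (a' \<oplus>\<^bsub>W\<^esub> s' \<cdot> b)"
      by (simp add: eq)
    then have "r1 \<cdot> a \<oplus>\<^bsub>W\<^esub> s \<cdot> (s1 \<cdot> b) = r1 \<cdot> a' \<oplus>\<^bsub>W\<^esub> s \<cdot> (s1 \<cdot> b)"
      by (simp add: comp_im_plus r1s'_x)
    moreover have "f \<cdot> (r1 \<cdot> a) = \<zero> (FObj P W) Y" "f \<cdot> (r1 \<cdot> a') = \<zero> (FObj P W) Y"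
      by (simp_all flip: s1f'_x)
    ultimately have r1a: "r1 \<cdot> a' = r1 \<cdot> a"
      by (intro uniquely_decomposing_cancel[OF dec_f, of W "r1 \<cdot> a'" "s1 \<cdot> b"]) simp_all
    define d where "d = r1 \<cdot> (s' \<cdot> b)"
    obtain z where [simp]: "z \<in> Arr C" "Dom C z = FObj P W" "Cod C z = R"
      "r1 \<cdot> z = \<zero> (FObj P W) X" and z: "s' \<cdot> b = z \<oplus>\<^bsub>W\<^esub> e \<cdot> d"
      unfolding d_def by (rule uniquely_decomposingE[OF dec_r1, of W "s' \<cdot> b"]) simp_all
    have [simp]: "d \<in> Arr C" "Dom C d = FObj P W" "Cod C d = X"
      by (simp_all add: d_def)
    obtain y where [simp]: "y \<in> Arr C" "Dom C y = FObj P W" "Cod C y = R"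
      "r1 \<cdot> y = \<zero> (FObj P W) X" and y: "a \<oplus>\<^bsub>W\<^esub> z = y \<oplus>\<^bsub>W\<^esub> e \<cdot> (r1 \<cdot> (a \<oplus>\<^bsub>W\<^esub> z))"
      by (rule uniquely_decomposingE[OF dec_r1, of W "a \<oplus>\<^bsub>W\<^esub> z"]) simp_all
    obtain y' where [simp]: "y' \<in> Arr C" "Dom C y' = FObj P W" "Cod C y' = R"
      "r1 \<cdot> y' = \<zero> (FObj P W) X" and y': "a' \<oplus>\<^bsub>W\<^esub> z = y' \<oplus>\<^bsub>W\<^esub> e \<cdot> (r1 \<cdot> (a' \<oplus>\<^bsub>W\<^esub> z))"
      by (rule uniquely_decomposingE[OF dec_r1, of W "a' \<oplus>\<^bsub>W\<^esub> z"]) simp_all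
    \<comment> \<open>\<open>z\<close> lies in the kernel of \<open>r1\<close>, so both sums have \<open>r1\<close>-component \<open>r1 \<cdot> a\<close>.\<close>
    have az: "a \<oplus>\<^bsub>W\<^esub> z = y \<oplus>\<^bsub>W\<^esub> e \<cdot> (r1 \<cdot> a)" "a' \<oplus>\<^bsub>W\<^esub> z = y' \<oplus>\<^bsub>W\<^esub> e \<cdot> (r1 \<cdot> a)"
      using y y' by (simp_all add: comp_im_plus im_plus_zero r1a)
    have "y \<oplus>\<^bsub>W\<^esub> e \<cdot> (r1 \<cdot> a \<oplus>\<^bsub>W\<^esub> d) = (a \<oplus>\<^bsub>W\<^esub> z) \<oplus>\<^bsub>W\<^esub> e \<cdot> d"
      by (simp add: az(1) comp_im_plus im_plus_assoc)
    also have "\<dots> = a \<oplus>\<^bsub>W\<^esub> s' \<cdot> b"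
      by (simp add: z im_plus_assoc)
    also have "\<dots> = (a' \<oplus>\<^bsub>W\<^esub> z) \<oplus>\<^bsub>W\<^esub> e \<cdot> d"
      unfolding eq by (simp add: z im_plus_assoc)
    also have "\<dots> = y' \<oplus>\<^bsub>W\<^esub> e \<cdot> (r1 \<cdot> a \<oplus>\<^bsub>W\<^esub> d)"
      by (simp add: az(2) comp_im_plus im_plus_assoc)
    finally have "y = y'"
      by (rule uniquely_decomposing_cancel[OF dec_r1, rotated]) simp_all
    then have az_eq: "a \<oplus>\<^bsub>W\<^esub> z = a' \<oplus>\<^bsub>W\<^esub> z"
      using az by simp
    obtain n where [simp]: "n \<in> Arr C" "Dom C n = FObj P W" "Cod C n = R"
      and n: "z \<oplus>\<^bsub>W\<^esub> n = \<zero> (FObj P W) R"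
      using inverse[of W z] by auto
    have "a = a \<oplus>\<^bsub>W\<^esub> (z \<oplus>\<^bsub>W\<^esub> n)"
      by (simp add: n im_plus_zero)
    also have "\<dots> = (a' \<oplus>\<^bsub>W\<^esub> z) \<oplus>\<^bsub>W\<^esub> n"
      by (simp add: im_plus_assoc flip: az_eq)
    also have "\<dots> = a'"
      by (simp add: im_plus_assoc n im_plus_zero)
    finally show ?thesis .
  qed
  ultimately show ?thesis
    by (intro uniquely_decomposingI[of f' R S]) simp_all
qed

lemma equi_consistent_intrinsic_schreier:
  "equi_consistent C (intrinsic_schreier C P t)"
proof -
  have points: "intrinsic_schreier C P t \<subseteq> points C"
    unfolding intrinsic_schreier_def by blast
  have "pullback_stable C (intrinsic_schreier C P t)"
    unfolding pullback_stable_def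
  proof (clarify)
    fix f s g p f' s'
    assume fs: "(f, s) \<in> intrinsic_schreier C P t" and pb: "is_pullback C f g p f'"
      and s': "s' \<in> hom C (Cod C f') (Dom C f')" "p \<cdot> s' = s \<cdot> g" "f' \<cdot> s' = \<one> (Cod C f')"
    have "(f', s') \<in> points C"
      using pb s' by (auto simp: points_def is_pullback_def hom_iff)
    then show "(f', s') \<in> intrinsic_schreier C P t"
      using uniquely_decomposing_pullback[OF intrinsic_schreier_decomposing[OF fs] _ pb s']
        points fs decomposing_intrinsic_schreier by blast
  qed
  moreover have "(f', s') \<in> intrinsic_schreier C P t"
    if "equivalence_relation C X R r1 r2" "e \<in> hom C X R" "r1 \<cdot> e = \<one> X" "r2 \<cdot> e = \<one> X"
      "f \<in> hom C X Y" "(f, s) \<in> points C" "f' \<in> hom C R S" "(f', s') \<in> points C"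
      "e' \<in> hom C Y S" "equivalence_relation C Y S s1 s2"
      "s1 \<cdot> f' = f \<cdot> r1" "r1 \<cdot> s' = s \<cdot> s1" "f' \<cdot> e = e' \<cdot> f" "s' \<cdot> e' = e \<cdot> s"
      "(f, s) \<in> intrinsic_schreier C P t" "(r1, e) \<in> intrinsic_schreier C P t"
    for X Y R S f s r1 r2 s1 s2 e e' f' s'
  proof -
    have "s1 \<in> hom C S Y"
      using that by (simp add: equivalence_relation_def)
    then show ?thesis
      using that intrinsic_schreier_decomposing
      by (intro decomposing_intrinsic_schreier
          uniquely_decomposing_equi_consistent[of X R r1 r2 e f Y s f' S s' e' s1])
  qed
  ultimately show ?thesis
    using points unfolding equi_consistent_def by blast
qed

end

theorem proposition7p7:
  fixes C :: "('o, 'm) bicat"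
    and P :: "('o, 'm) comonad_data"
    and t :: "'o \<Rightarrow> 'o \<Rightarrow> 'm"
  assumes "category C"
    and "chosen_products C"
    and "chosen_coproducts C"
    and "regular C"
    and "unital C"
    and "comonadic_covers C P"
    and "natural_imaginary_splitting C P t"
    and "im_add_associative C P t"
  shows "equi_consistent C (intrinsic_schreier C P t)"
proof -
  interpret category C
    by (rule assms(1))
  interpret comonad C P
    using assms(6) by (simp add: comonadic_covers_def)
  interpret imaginary_addition_kernels C P t
    by unfold_locales (use assms in \<open>auto simp: unital_def\<close>)
  show ?thesis
    by (rule equi_consistent_intrinsic_schreier)
qed

end
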